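(* Let $r:M\to M'$ be an epimorphism and $s:N'\to N$ a monomorphism in an abelian category $\mathcal{A}$. (1) If $r$ is a retraction and $N$ is $M$-CS-Rickart, then $N'$ is $M'$-CS-Rickart. (2) If $s$ is a section and $N$ is dual $M$-CS-Rickart, then $N'$ is dual $M'$-CS-Rickart.
   Context: A section is a split monomorphism (a morphism with a left inverse) and a retraction is a split epimorphism (a morphism with a right inverse). A subobject $K$ of $L$ is essential in $L$ if $K\cap X=0$ implies $X=0$ for every subobject $X$ of $L$; $K$ is superfluous in $L$ if $K+X=L$ implies $X=L$ for every subobject $X$ of $L$. A subobject $L$ of $M$ lies above a direct summand of $M$ if $L$ contains a direct summand $K$ of $M$ such that $L/K$ is superfluous in $M/K$. For objects $M,N$ of an abelian category: $N$ is $M$-CS-Rickart if for every morphism $f:M\to N$, $\mathrm{Ker}(f)$ is essential in a direct summand of $M$; $N$ is dual $M$-CS-Rickart if for every morphism $f:M\to N$, $\mathrm{Im}(f)$ lies above a direct summand of $N$. *)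

theory Defs
  imports "HOL-Algebra.Group"
begin

text \<open>
  A category enriched in abelian groups. Objects and arrows are carved out of arbitrary types by
  \<open>Ob\<close> and \<open>Ar\<close>; composition \<open>g \<cdot> f\<close> means first \<open>f\<close>, then \<open>g\<close>, and, like addition,
  it is only constrained on matching arrows.
\<close>

record ('o, 'm) precat =
  Ob   :: "'o set"
  Ar   :: "'m set"
  Dom  :: "'m \<Rightarrow> 'o"
  Cod  :: "'m \<Rightarrow> 'o"
  Idt  :: "'o \<Rightarrow> 'm"
  Comp :: "'m \<Rightarrow> 'm \<Rightarrow> 'm"  (infixl "\<cdot>\<index>" 70)
  Plus :: "'m \<Rightarrow> 'm \<Rightarrow> 'm"
  Zero :: "'o \<Rightarrow> 'o \<Rightarrow> 'm"

definition Hom :: "('o, 'm, 'z) precat_scheme \<Rightarrow> 'o \<Rightarrow> 'o \<Rightarrow> 'm set" where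
  "Hom C A B = {f \<in> Ar C. Dom C f = A \<and> Cod C f = B}"

definition hom_group :: "('o, 'm, 'z) precat_scheme \<Rightarrow> 'o \<Rightarrow> 'o \<Rightarrow> 'm monoid" where
  "hom_group C A B = \<lparr>carrier = Hom C A B, monoid.mult = Plus C, one = Zero C A B\<rparr>"

locale preadditive_category =
  fixes C :: "('o, 'm, 'z) precat_scheme" (structure)
  assumes Dom_Ob: "f \<in> Ar C \<Longrightarrow> Dom C f \<in> Ob C"
    and Cod_Ob: "f \<in> Ar C \<Longrightarrow> Cod C f \<in> Ob C"
    and Idt_Hom: "A \<in> Ob C \<Longrightarrow> Idt C A \<in> Hom C A A"
    and Comp_Hom: "\<lbrakk>f \<in> Hom C A B; g \<in> Hom C B D\<rbrakk> \<Longrightarrow> g \<cdot> f \<in> Hom C A D"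
    and Comp_assoc:
      "\<lbrakk>f \<in> Hom C A B; g \<in> Hom C B D; h \<in> Hom C D E\<rbrakk> \<Longrightarrow> h \<cdot> g \<cdot> f = h \<cdot> (g \<cdot> f)"
    and Comp_Idt_right: "f \<in> Hom C A B \<Longrightarrow> f \<cdot> Idt C A = f"
    and Comp_Idt_left: "f \<in> Hom C A B \<Longrightarrow> Idt C B \<cdot> f = f"
    and Hom_comm_group: "\<lbrakk>A \<in> Ob C; B \<in> Ob C\<rbrakk> \<Longrightarrow> comm_group (hom_group C A B)"
    and Comp_Plus_right:
      "\<lbrakk>f \<in> Hom C A B; f' \<in> Hom C A B; g \<in> Hom C B D\<rbrakk>
       \<Longrightarrow> g \<cdot> Plus C f f' = Plus C (g \<cdot> f) (g \<cdot> f')"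
    and Comp_Plus_left:
      "\<lbrakk>f \<in> Hom C A B; g \<in> Hom C B D; g' \<in> Hom C B D\<rbrakk>
       \<Longrightarrow> Plus C g g' \<cdot> f = Plus C (g \<cdot> f) (g' \<cdot> f)"

definition monic :: "('o, 'm, 'z) precat_scheme \<Rightarrow> 'm \<Rightarrow> bool" where
  "monic C f \<longleftrightarrow> f \<in> Ar C \<and>
     (\<forall>X. \<forall>g\<in>Hom C X (Dom C f). \<forall>h\<in>Hom C X (Dom C f). f \<cdot>\<^bsub>C\<^esub> g = f \<cdot>\<^bsub>C\<^esub> h \<longrightarrow> g = h)"

definition epic :: "('o, 'm, 'z) precat_scheme \<Rightarrow> 'm \<Rightarrow> bool" where
  "epic C f \<longleftrightarrow> f \<in> Ar C \<and>
     (\<forall>X. \<forall>g\<in>Hom C (Cod C f) X. \<forall>h\<in>Hom C (Cod C f) X. g \<cdot>\<^bsub>C\<^esub> f = h \<cdot>\<^bsub>C\<^esub> f \<longrightarrow> g = h)"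

definition is_section :: "('o, 'm, 'z) precat_scheme \<Rightarrow> 'm \<Rightarrow> bool" where
  "is_section C f \<longleftrightarrow> f \<in> Ar C \<and>
     (\<exists>g\<in>Hom C (Cod C f) (Dom C f). g \<cdot>\<^bsub>C\<^esub> f = Idt C (Dom C f))"

definition is_retraction :: "('o, 'm, 'z) precat_scheme \<Rightarrow> 'm \<Rightarrow> bool" where
  "is_retraction C f \<longleftrightarrow> f \<in> Ar C \<and>
     (\<exists>g\<in>Hom C (Cod C f) (Dom C f). f \<cdot>\<^bsub>C\<^esub> g = Idt C (Cod C f))"

definition is_iso :: "('o, 'm, 'z) precat_scheme \<Rightarrow> 'm \<Rightarrow> bool" where
  "is_iso C f \<longleftrightarrow> f \<in> Ar C \<and>
     (\<exists>g\<in>Hom C (Cod C f) (Dom C f).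
        g \<cdot>\<^bsub>C\<^esub> f = Idt C (Dom C f) \<and> f \<cdot>\<^bsub>C\<^esub> g = Idt C (Cod C f))"

definition zero_object :: "('o, 'm, 'z) precat_scheme \<Rightarrow> 'o \<Rightarrow> bool" where
  "zero_object C Z \<longleftrightarrow> Z \<in> Ob C \<and>
     (\<forall>A\<in>Ob C. (\<exists>!f. f \<in> Hom C A Z) \<and> (\<exists>!f. f \<in> Hom C Z A))"

definition is_kernel :: "('o, 'm, 'z) precat_scheme \<Rightarrow> 'm \<Rightarrow> 'm \<Rightarrow> bool" where
  "is_kernel C f k \<longleftrightarrow> f \<in> Ar C \<and> k \<in> Ar C \<and> Cod C k = Dom C f \<and>
     f \<cdot>\<^bsub>C\<^esub> k = Zero C (Dom C k) (Cod C f) \<and>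
     (\<forall>X. \<forall>g\<in>Hom C X (Dom C f). f \<cdot>\<^bsub>C\<^esub> g = Zero C X (Cod C f) \<longrightarrow>
        (\<exists>!h. h \<in> Hom C X (Dom C k) \<and> k \<cdot>\<^bsub>C\<^esub> h = g))"

definition is_cokernel :: "('o, 'm, 'z) precat_scheme \<Rightarrow> 'm \<Rightarrow> 'm \<Rightarrow> bool" where
  "is_cokernel C f c \<longleftrightarrow> f \<in> Ar C \<and> c \<in> Ar C \<and> Dom C c = Cod C f \<and>
     c \<cdot>\<^bsub>C\<^esub> f = Zero C (Dom C f) (Cod C c) \<and>
     (\<forall>X. \<forall>g\<in>Hom C (Cod C f) X. g \<cdot>\<^bsub>C\<^esub> f = Zero C (Dom C f) X \<longrightarrow>
        (\<exists>!h. h \<in> Hom C (Cod C c) X \<and> h \<cdot>\<^bsub>C\<^esub> c = g))"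

definition is_image :: "('o, 'm, 'z) precat_scheme \<Rightarrow> 'm \<Rightarrow> 'm \<Rightarrow> bool" where
  "is_image C f i \<longleftrightarrow> (\<exists>c. is_cokernel C f c \<and> is_kernel C c i)"

text \<open>\<open>M = A \<oplus> B\<close> with injections \<open>u\<close>, \<open>v\<close> and projections \<open>p\<close>, \<open>q\<close>.\<close>

definition is_biproduct ::
  "('o, 'm, 'z) precat_scheme \<Rightarrow> 'o \<Rightarrow> 'o \<Rightarrow> 'o \<Rightarrow> 'm \<Rightarrow> 'm \<Rightarrow> 'm \<Rightarrow> 'm \<Rightarrow> bool" where
  "is_biproduct C A B M u v p q \<longleftrightarrow>
     u \<in> Hom C A M \<and> v \<in> Hom C B M \<and> p \<in> Hom C M A \<and> q \<in> Hom C M B \<and>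
     p \<cdot>\<^bsub>C\<^esub> u = Idt C A \<and> q \<cdot>\<^bsub>C\<^esub> v = Idt C B \<and>
     p \<cdot>\<^bsub>C\<^esub> v = Zero C B A \<and> q \<cdot>\<^bsub>C\<^esub> u = Zero C A B \<and>
     Plus C (u \<cdot>\<^bsub>C\<^esub> p) (v \<cdot>\<^bsub>C\<^esub> q) = Idt C M"

locale abelian_category = preadditive_category +
  assumes ex_zero_object: "\<exists>Z. zero_object C Z"
    and ex_biproduct:
      "\<lbrakk>A \<in> Ob C; B \<in> Ob C\<rbrakk> \<Longrightarrow> \<exists>M u v p q. is_biproduct C A B M u v p q"
    and ex_kernel: "f \<in> Ar C \<Longrightarrow> \<exists>k. is_kernel C f k"
    and ex_cokernel: "f \<in> Ar C \<Longrightarrow> \<exists>c. is_cokernel C f c"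
    and monic_normal: "monic C f \<Longrightarrow> \<exists>g. is_kernel C g f"
    and epic_conormal: "epic C f \<Longrightarrow> \<exists>g. is_cokernel C g f"

text \<open>
  A subobject of \<open>L\<close> is represented by a monomorphism into \<open>L\<close>, and equality of subobjects by
  mutual \<open>sub_le\<close>. Hence ``\<open>X = 0\<close>'' says that the domain of \<open>x\<close> is a zero object, and
  ``\<open>X = L\<close>'' that \<open>x\<close> is an isomorphism. Intersections and sums are meets and joins in the
  resulting preorder, unique up to equality of subobjects.
\<close>

definition subobject :: "('o, 'm, 'z) precat_scheme \<Rightarrow> 'm \<Rightarrow> 'o \<Rightarrow> bool" where
  "subobject C k L \<longleftrightarrow> monic C k \<and> Cod C k = L"

definition sub_le :: "('o, 'm, 'z) precat_scheme \<Rightarrow> 'm \<Rightarrow> 'm \<Rightarrow> bool" where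
  "sub_le C k l \<longleftrightarrow> (\<exists>h\<in>Hom C (Dom C k) (Dom C l). l \<cdot>\<^bsub>C\<^esub> h = k)"

definition is_intersection ::
  "('o, 'm, 'z) precat_scheme \<Rightarrow> 'o \<Rightarrow> 'm \<Rightarrow> 'm \<Rightarrow> 'm \<Rightarrow> bool" where
  "is_intersection C L k x i \<longleftrightarrow> subobject C i L \<and> sub_le C i k \<and> sub_le C i x \<and>
     (\<forall>j. subobject C j L \<and> sub_le C j k \<and> sub_le C j x \<longrightarrow> sub_le C j i)"

definition is_sum ::
  "('o, 'm, 'z) precat_scheme \<Rightarrow> 'o \<Rightarrow> 'm \<Rightarrow> 'm \<Rightarrow> 'm \<Rightarrow> bool" where
  "is_sum C L k x t \<longleftrightarrow> subobject C t L \<and> sub_le C k t \<and> sub_le C x t \<and>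
     (\<forall>j. subobject C j L \<and> sub_le C k j \<and> sub_le C x j \<longrightarrow> sub_le C t j)"

definition essential_in :: "('o, 'm, 'z) precat_scheme \<Rightarrow> 'm \<Rightarrow> 'o \<Rightarrow> bool" where
  "essential_in C k L \<longleftrightarrow> subobject C k L \<and>
     (\<forall>x. subobject C x L \<longrightarrow>
        (\<exists>i. is_intersection C L k x i \<and> zero_object C (Dom C i)) \<longrightarrow> zero_object C (Dom C x))"

definition superfluous_in :: "('o, 'm, 'z) precat_scheme \<Rightarrow> 'm \<Rightarrow> 'o \<Rightarrow> bool" where
  "superfluous_in C k L \<longleftrightarrow> subobject C k L \<and>
     (\<forall>x. subobject C x L \<longrightarrow> (\<exists>t. is_sum C L k x t \<and> is_iso C t) \<longrightarrow> is_iso C x)"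

definition direct_summand :: "('o, 'm, 'z) precat_scheme \<Rightarrow> 'm \<Rightarrow> 'o \<Rightarrow> bool" where
  "direct_summand C u M \<longleftrightarrow> subobject C u M \<and>
     (\<exists>B v p q. is_biproduct C (Dom C u) B M u v p q)"

text \<open>Below, \<open>h\<close> is the inclusion of the subobject \<open>k\<close> of \<open>M\<close> into the direct summand \<open>u\<close>.\<close>

definition essential_in_direct_summand ::
  "('o, 'm, 'z) precat_scheme \<Rightarrow> 'm \<Rightarrow> 'o \<Rightarrow> bool" where
  "essential_in_direct_summand C k M \<longleftrightarrow> subobject C k M \<and>
     (\<exists>u h. direct_summand C u M \<and> h \<in> Hom C (Dom C k) (Dom C u) \<and> u \<cdot>\<^bsub>C\<^esub> h = k \<and>
        essential_in C h (Dom C u))"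

text \<open>
  Below, \<open>h : K \<rightarrow> L\<close> is the inclusion of the direct summand \<open>k\<close> into \<open>l\<close>, the arrows
  \<open>c : M \<rightarrow> M/K\<close> and \<open>d : L \<rightarrow> L/K\<close> are the cokernels of \<open>k\<close> and \<open>h\<close>, and
  \<open>j : L/K \<rightarrow> M/K\<close> is the arrow induced by \<open>l\<close>.
\<close>

definition lies_above_direct_summand ::
  "('o, 'm, 'z) precat_scheme \<Rightarrow> 'm \<Rightarrow> 'o \<Rightarrow> bool" where
  "lies_above_direct_summand C l M \<longleftrightarrow> subobject C l M \<and>
     (\<exists>k h c d j. direct_summand C k M \<and> h \<in> Hom C (Dom C k) (Dom C l) \<and> l \<cdot>\<^bsub>C\<^esub> h = k \<and>
        is_cokernel C k c \<and> is_cokernel C h d \<and>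
        j \<in> Hom C (Cod C d) (Cod C c) \<and> j \<cdot>\<^bsub>C\<^esub> d = c \<cdot>\<^bsub>C\<^esub> l \<and>
        superfluous_in C j (Cod C c))"

text \<open>
  \<open>CS_Rickart C M N\<close>: the object \<open>N\<close> is \<open>M\<close>-CS-Rickart; similarly for the dual notion. Kernels
  and images are only determined up to isomorphism, so all of them are quantified over.
\<close>

definition CS_Rickart :: "('o, 'm, 'z) precat_scheme \<Rightarrow> 'o \<Rightarrow> 'o \<Rightarrow> bool" where
  "CS_Rickart C M N \<longleftrightarrow>
     (\<forall>f\<in>Hom C M N. \<forall>k. is_kernel C f k \<longrightarrow> essential_in_direct_summand C k M)"

definition dual_CS_Rickart :: "('o, 'm, 'z) precat_scheme \<Rightarrow> 'o \<Rightarrow> 'o \<Rightarrow> bool" where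
  "dual_CS_Rickart C M N \<longleftrightarrow>
     (\<forall>f\<in>Hom C M N. \<forall>i. is_image C f i \<longrightarrow> lies_above_direct_summand C i N)"

end

theory Submission imports Defs begin

text \<open>
  A retraction \<open>r : M \<rightarrow> M'\<close> with section \<open>g\<close> presents \<open>M'\<close> as a direct summand of \<open>M\<close> with
  complement \<open>Ker r\<close>. For \<open>f : M' \<rightarrow> N'\<close>, put \<open>F = s \<cdot> (f \<cdot> r)\<close>. Since \<open>s\<close> is monic, \<open>Ker F\<close> is
  \<open>Ker f \<oplus> Ker r\<close>. If it is essential in a direct summand \<open>U\<close> of \<open>M\<close>, then \<open>U\<close> contains \<open>Ker r\<close>, so
  the modular law splits \<open>U\<close> as \<open>U' \<oplus> Ker r\<close>, and \<open>Ker f\<close> is essential in the direct summand \<open>U'\<close>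
  of \<open>M'\<close>. In terms of arrows: if the idempotent \<open>e\<close> projects onto \<open>U\<close>, then \<open>r \<cdot> (e \<cdot> g)\<close> is an
  idempotent that projects onto \<open>U'\<close>.

  The argument is carried out with idempotents because the second part then follows from the
  first by duality. ``\<open>Ker f\<close> is essential in a direct summand'' is equivalent to the existence of an
  idempotent with two properties that only mention composition, zero arrows and monomorphisms
  (\<open>kernel_envelope\<close>); see \<open>kernel_essential_in_summand_iff\<close>. ``\<open>Im f\<close> lies above a direct summand''
  is equivalent to the same condition in the opposite category; see \<open>image_above_summand_iff\<close>.
  There the idempotent projects onto the complement of the summand. The lemma
  \<open>kernel_envelope_descends\<close> passes from \<open>e\<close> to \<open>r \<cdot> (e \<cdot> g)\<close>. It holds in every
  preadditive category, hence in the opposite category, with the section \<open>s\<close> in the role of the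
  retraction and the epimorphism \<open>r\<close> in the role of the monomorphism.

  The two equivalences rest on descriptions of essential and superfluous subobjects by arrows,
  \<open>essential_in_iff\<close> and \<open>superfluous_in_iff\<close>, and on the splitting of idempotents in an abelian
  category, \<open>idempotent_biproduct\<close>.
\<close>

section \<open>Arrows in a preadditive category\<close>

context preadditive_category
begin

lemma HomI: "f \<in> Ar C \<Longrightarrow> Dom C f = A \<Longrightarrow> Cod C f = B \<Longrightarrow> f \<in> Hom C A B"
  by (simp add: Hom_def)

lemma Hom_Ob: "f \<in> Hom C A B \<Longrightarrow> A \<in> Ob C \<and> B \<in> Ob C"
  using Dom_Ob Cod_Ob by (auto simp: Hom_def)

lemma Comp_Ar:
  assumes "f \<in> Ar C" "g \<in> Ar C" "Cod C f = Dom C g"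
  shows "g \<cdot> f \<in> Ar C" "Dom C (g \<cdot> f) = Dom C f" "Cod C (g \<cdot> f) = Cod C g"
  using Comp_Hom[of f "Dom C f" "Dom C g" g "Cod C g"] assms by (auto simp: Hom_def)

lemma Comp_assoc_Ar:
  assumes "f \<in> Ar C" "g \<in> Ar C" "h \<in> Ar C" "Cod C f = Dom C g" "Cod C g = Dom C h"
  shows "h \<cdot> g \<cdot> f = h \<cdot> (g \<cdot> f)"
  by (rule Comp_assoc) (use assms in \<open>auto simp: Hom_def\<close>)

lemma Idt_Ar:
  assumes "A \<in> Ob C"
  shows "Idt C A \<in> Ar C" "Dom C (Idt C A) = A" "Cod C (Idt C A) = A"
  using Idt_Hom[OF assms] by (auto simp: Hom_def)

lemma Comp_Idt_Ar:
  assumes "f \<in> Ar C"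
  shows "Dom C f = A \<Longrightarrow> f \<cdot> Idt C A = f" "Cod C f = B \<Longrightarrow> Idt C B \<cdot> f = f"
  using Comp_Idt_right[of f] Comp_Idt_left[of f] assms by (auto simp: Hom_def)

lemma Zero_Hom:
  assumes "A \<in> Ob C" "B \<in> Ob C"
  shows "Zero C A B \<in> Hom C A B"
proof -
  interpret G: comm_group "hom_group C A B" using assms by (rule Hom_comm_group)
  show ?thesis using G.one_closed by (simp add: hom_group_def)
qed

lemma Zero_Ar:
  assumes "A \<in> Ob C" "B \<in> Ob C"
  shows "Zero C A B \<in> Ar C" "Dom C (Zero C A B) = A" "Cod C (Zero C A B) = B"
  using Zero_Hom[OF assms] by (auto simp: Hom_def)

lemma Plus_Zero:
  assumes "f \<in> Hom C A B"
  shows "Plus C f (Zero C A B) = f" "Plus C (Zero C A B) f = f"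
proof -
  interpret G: comm_group "hom_group C A B" using assms Hom_Ob Hom_comm_group by blast
  show "Plus C f (Zero C A B) = f" "Plus C (Zero C A B) f = f"
    using G.r_one[of f] G.l_one[of f] assms by (simp_all add: hom_group_def)
qed

lemma Plus_cancel_left:
  assumes "f \<in> Hom C A B" "g \<in> Hom C A B" "h \<in> Hom C A B" "Plus C f g = Plus C f h"
  shows "g = h"
proof -
  interpret G: comm_group "hom_group C A B" using assms Hom_Ob Hom_comm_group by blast
  show ?thesis using G.Units_l_cancel[of f g h] G.Units_eq assms by (simp add: hom_group_def)
qed

lemma Plus_commute:
  assumes "f \<in> Hom C A B" "g \<in> Hom C A B"
  shows "Plus C f g = Plus C g f"
proof -
  interpret G: comm_group "hom_group C A B" using assms Hom_Ob Hom_comm_group by blast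
  show ?thesis using G.m_comm[of f g] assms by (simp add: hom_group_def)
qed

lemma ex_summand:
  assumes "f \<in> Hom C A B" "g \<in> Hom C A B"
  shows "\<exists>d\<in>Hom C A B. Plus C f d = g"
proof -
  interpret G: comm_group "hom_group C A B" using assms Hom_Ob Hom_comm_group by blast
  let ?G = "hom_group C A B"
  have "f \<in> carrier ?G" "g \<in> carrier ?G" using assms by (simp_all add: hom_group_def)
  then have "f \<otimes>\<^bsub>?G\<^esub> (inv\<^bsub>?G\<^esub> f \<otimes>\<^bsub>?G\<^esub> g) = g" "inv\<^bsub>?G\<^esub> f \<otimes>\<^bsub>?G\<^esub> g \<in> carrier ?G"
    by (simp_all add: G.m_assoc[symmetric])
  then show ?thesis by (auto simp: hom_group_def)
qed

lemma Plus_eq_imp_Zero: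
  assumes "f \<in> Hom C A B" "g \<in> Hom C A B" "Plus C f g = f"
  shows "g = Zero C A B"
  using Plus_cancel_left[of f A B g "Zero C A B"] assms Plus_Zero Zero_Hom Hom_Ob by metis

lemma Comp_Zero_right:
  assumes "g \<in> Ar C" "Dom C g = B" "A \<in> Ob C"
  shows "g \<cdot> Zero C A B = Zero C A (Cod C g)"
proof -
  have g: "g \<in> Hom C B (Cod C g)" and z: "Zero C A B \<in> Hom C A B"
    using assms Zero_Hom Dom_Ob by (auto simp: Hom_def)
  from g z have "Plus C (g \<cdot> Zero C A B) (g \<cdot> Zero C A B) = g \<cdot> Zero C A B"
    using Comp_Plus_right Plus_Zero by metis
  then show ?thesis using Plus_eq_imp_Zero Comp_Hom g z by blast
qed

lemma Comp_Zero_left: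
  assumes "f \<in> Ar C" "Cod C f = B" "D \<in> Ob C"
  shows "Zero C B D \<cdot> f = Zero C (Dom C f) D"
proof -
  have f: "f \<in> Hom C (Dom C f) B" and z: "Zero C B D \<in> Hom C B D"
    using assms Zero_Hom Cod_Ob by (auto simp: Hom_def)
  from f z have "Plus C (Zero C B D \<cdot> f) (Zero C B D \<cdot> f) = Zero C B D \<cdot> f"
    using Comp_Plus_left Plus_Zero by metis
  then show ?thesis using Plus_eq_imp_Zero Comp_Hom f z by blast
qed

text \<open>
  With domains and codomains as equations instead of membership in \<open>Hom\<close>, the simplifier finds the
  intermediate objects of a composite by itself; it associates composites to the right.
\<close>

lemmas cat_simps = Comp_Ar Comp_assoc_Ar Idt_Ar Comp_Idt_Ar Zero_Ar Comp_Zero_right Comp_Zero_left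
  Dom_Ob Cod_Ob

lemma monic_cancel:
  assumes "monic C m" "g \<in> Ar C" "h \<in> Ar C" "Dom C g = Dom C h"
    "Cod C g = Dom C m" "Cod C h = Dom C m" "m \<cdot> g = m \<cdot> h"
  shows "g = h"
  using assms unfolding monic_def by (metis HomI)

lemma epic_cancel:
  assumes "epic C m" "g \<in> Ar C" "h \<in> Ar C" "Cod C g = Cod C h"
    "Dom C g = Cod C m" "Dom C h = Cod C m" "g \<cdot> m = h \<cdot> m"
  shows "g = h"
  using assms unfolding epic_def by (metis HomI)

lemma monic_Ar: "monic C m \<Longrightarrow> m \<in> Ar C" by (simp add: monic_def)
lemma epic_Ar: "epic C m \<Longrightarrow> m \<in> Ar C" by (simp add: epic_def)

lemma monic_zero_cancel:
  assumes "monic C m" "g \<in> Ar C" "Cod C g = Dom C m" "m \<cdot> g = Zero C (Dom C g) (Cod C m)"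
  shows "g = Zero C (Dom C g) (Dom C m)"
  by (rule monic_cancel[of m]) (use assms monic_Ar in \<open>auto simp: cat_simps\<close>)

lemma epic_zero_cancel:
  assumes "epic C m" "g \<in> Ar C" "Dom C g = Cod C m" "g \<cdot> m = Zero C (Dom C m) (Cod C g)"
  shows "g = Zero C (Cod C m) (Cod C g)"
  by (rule epic_cancel[of m]) (use assms epic_Ar in \<open>auto simp: cat_simps\<close>)

lemma monic_Comp:
  assumes "monic C m" "monic C n" "Cod C m = Dom C n"
  shows "monic C (n \<cdot> m)"
  unfolding monic_def
proof (intro conjI allI ballI impI)
  show "n \<cdot> m \<in> Ar C" using assms monic_Ar by (simp add: cat_simps)
  fix X g h
  assume "g \<in> Hom C X (Dom C (n \<cdot> m))" "h \<in> Hom C X (Dom C (n \<cdot> m))"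
    and e: "n \<cdot> m \<cdot> g = n \<cdot> m \<cdot> h"
  then have gh: "g \<in> Ar C" "h \<in> Ar C" "Dom C g = X" "Dom C h = X"
    "Cod C g = Dom C m" "Cod C h = Dom C m"
    using assms monic_Ar by (auto simp: Hom_def cat_simps)
  note mn = assms monic_Ar[OF assms(1)] monic_Ar[OF assms(2)]
  have "n \<cdot> (m \<cdot> g) = n \<cdot> (m \<cdot> h)" using e gh mn by (simp add: cat_simps)
  then have "m \<cdot> g = m \<cdot> h"
    by - (rule monic_cancel[OF assms(2)]; use gh mn in \<open>auto simp: cat_simps\<close>)
  then show "g = h" by - (rule monic_cancel[OF assms(1)]; use gh in auto)
qed

lemma monic_factor:
  assumes "monic C (n \<cdot> m)" "m \<in> Ar C" "n \<in> Ar C" "Cod C m = Dom C n"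
  shows "monic C m"
  unfolding monic_def
proof (intro conjI allI ballI impI)
  fix X g h
  assume "g \<in> Hom C X (Dom C m)" "h \<in> Hom C X (Dom C m)" and e: "m \<cdot> g = m \<cdot> h"
  then have gh: "g \<in> Ar C" "h \<in> Ar C" "Dom C g = X" "Dom C h = X"
    "Cod C g = Dom C m" "Cod C h = Dom C m" by (auto simp: Hom_def)
  show "g = h"
    by - (rule monic_cancel[OF assms(1)]; use gh assms e in \<open>auto simp: cat_simps\<close>)
qed (use assms in auto)

lemma monic_left_inverse:
  assumes "m \<in> Hom C A B" "l \<in> Hom C B A" "l \<cdot> m = Idt C A"
  shows "monic C m"
proof (rule monic_factor[of l])
  have A: "A \<in> Ob C" using assms Hom_Ob by blast
  have "monic C (Idt C A)" unfolding monic_def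
    using A by (auto simp: cat_simps Hom_def)
  then show "monic C (l \<cdot> m)" using assms by simp
qed (use assms in \<open>auto simp: Hom_def\<close>)

text \<open>
  Two arrows that agree after composition with \<open>m\<close> differ by an arrow that \<open>m\<close> kills.
\<close>

lemma monic_if_zero_cancel:
  assumes "m \<in> Hom C A B"
    and "\<And>X w. w \<in> Hom C X A \<Longrightarrow> m \<cdot> w = Zero C X B \<Longrightarrow> w = Zero C X A"
  shows "monic C m"
  unfolding monic_def
proof (intro conjI allI ballI impI)
  show "m \<in> Ar C" using assms(1) by (simp add: Hom_def)
  fix X g h
  assume "g \<in> Hom C X (Dom C m)" "h \<in> Hom C X (Dom C m)" and e: "m \<cdot> g = m \<cdot> h"
  then have gh: "g \<in> Hom C X A" "h \<in> Hom C X A" using assms(1) by (auto simp: Hom_def)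
  obtain d where d: "d \<in> Hom C X A" "Plus C h d = g" using ex_summand[OF gh(2,1)] by blast
  have "Plus C (m \<cdot> h) (m \<cdot> d) = m \<cdot> h"
    using Comp_Plus_right[OF gh(2) d(1) assms(1)] d(2) e by simp
  then have "m \<cdot> d = Zero C X B" using Plus_eq_imp_Zero Comp_Hom gh(2) d(1) assms(1) by blast
  then show "g = h" using assms(2) d Plus_Zero gh by metis
qed

lemma zero_object_iff_Idt:
  assumes "A \<in> Ob C"
  shows "zero_object C A \<longleftrightarrow> Idt C A = Zero C A A"
proof
  assume "zero_object C A"
  then show "Idt C A = Zero C A A"
    unfolding zero_object_def using assms Idt_Hom Zero_Hom by metis
next
  assume e: "Idt C A = Zero C A A"
  have "f = Zero C B A" if "f \<in> Hom C B A" for B f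
    using that e Comp_Idt_left[OF that] Comp_Zero_left[of f A A] assms by (auto simp: Hom_def)
  moreover have "f = Zero C A B" if "f \<in> Hom C A B" for B f
    using that e Comp_Idt_right[OF that] Comp_Zero_right[of f A A] assms by (auto simp: Hom_def)
  ultimately show "zero_object C A"
    unfolding zero_object_def using assms Zero_Hom by metis
qed

lemma zero_object_arrow:
  assumes "zero_object C A" "f \<in> Ar C" "Dom C f = A"
  shows "f = Zero C A (Cod C f)"
  using assms unfolding zero_object_def by (metis HomI Zero_Hom Cod_Ob)

text \<open>
  This turns ``the subobject \<open>x\<close> is \<open>0\<close>'' into an equation between arrows.
\<close>

lemma monic_zero_object_iff:
  assumes "monic C x"
  shows "zero_object C (Dom C x) \<longleftrightarrow> x = Zero C (Dom C x) (Cod C x)"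
proof
  assume "zero_object C (Dom C x)"
  then show "x = Zero C (Dom C x) (Cod C x)" using zero_object_arrow assms monic_Ar by blast
next
  note x = monic_Ar[OF assms]
  assume "x = Zero C (Dom C x) (Cod C x)"
  then have "Idt C (Dom C x) = Zero C (Dom C x) (Dom C x)"
    by - (rule monic_cancel[OF assms]; use x in \<open>auto simp: cat_simps\<close>)
  then show "zero_object C (Dom C x)" using zero_object_iff_Idt x Dom_Ob by blast
qed

lemma kernel_HomD:
  assumes "is_kernel C f k" "f \<in> Hom C M N"
  shows "k \<in> Hom C (Dom C k) M" "f \<cdot> k = Zero C (Dom C k) N"
  using assms by (auto simp: is_kernel_def Hom_def)

lemma kernel_factor:
  assumes "is_kernel C f k" "f \<in> Hom C M N" "g \<in> Hom C X M" "f \<cdot> g = Zero C X N"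
  shows "\<exists>h\<in>Hom C X (Dom C k). k \<cdot> h = g"
  using assms unfolding is_kernel_def Hom_def by blast

lemma kernel_monic:
  assumes "is_kernel C f k"
  shows "monic C k"
  unfolding monic_def
proof (intro conjI allI ballI impI)
  have k: "k \<in> Ar C" "f \<in> Ar C" "Cod C k = Dom C f" using assms by (auto simp: is_kernel_def)
  then show "k \<in> Ar C" by simp
  fix X g h
  assume g: "g \<in> Hom C X (Dom C k)" and h: "h \<in> Hom C X (Dom C k)" and e: "k \<cdot> g = k \<cdot> h"
  have "k \<cdot> g \<in> Hom C X (Dom C f)" "f \<cdot> (k \<cdot> g) = f \<cdot> k \<cdot> g"
    using g k by (auto simp: Hom_def cat_simps)
  moreover have "f \<cdot> k \<cdot> g = Zero C X (Cod C f)"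
    using assms g k by (auto simp: Hom_def cat_simps is_kernel_def simp del: Comp_assoc_Ar)
  ultimately have "\<exists>!a. a \<in> Hom C X (Dom C k) \<and> k \<cdot> a = k \<cdot> g"
    using assms unfolding is_kernel_def by metis
  then show "g = h" using g h e by metis
qed

lemma cokernel_HomD:
  assumes "is_cokernel C f c" "f \<in> Hom C M N"
  shows "c \<in> Hom C N (Cod C c)" "c \<cdot> f = Zero C M (Cod C c)"
  using assms by (auto simp: is_cokernel_def Hom_def)

lemma cokernel_factor:
  assumes "is_cokernel C f c" "f \<in> Hom C M N" "g \<in> Hom C N X" "g \<cdot> f = Zero C M X"
  shows "\<exists>h\<in>Hom C (Cod C c) X. h \<cdot> c = g"
  using assms unfolding is_cokernel_def Hom_def by blast

lemma cokernel_epic: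
  assumes "is_cokernel C f c"
  shows "epic C c"
  unfolding epic_def
proof (intro conjI allI ballI impI)
  have c: "c \<in> Ar C" "f \<in> Ar C" "Dom C c = Cod C f" using assms by (auto simp: is_cokernel_def)
  then show "c \<in> Ar C" by simp
  fix X g h
  assume g: "g \<in> Hom C (Cod C c) X" and h: "h \<in> Hom C (Cod C c) X" and e: "g \<cdot> c = h \<cdot> c"
  have "g \<cdot> c \<in> Hom C (Cod C f) X" "g \<cdot> c \<cdot> f = g \<cdot> (c \<cdot> f)"
    using g c by (auto simp: Hom_def cat_simps)
  moreover have "g \<cdot> (c \<cdot> f) = Zero C (Dom C f) X"
    using assms g c by (auto simp: Hom_def cat_simps is_cokernel_def)
  ultimately have "\<exists>!a. a \<in> Hom C (Cod C c) X \<and> a \<cdot> c = g \<cdot> c"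
    using assms unfolding is_cokernel_def by metis
  then show "g = h" using g h e by metis
qed

end

section \<open>The opposite category\<close>

definition opposite :: "('o, 'm, 'z) precat_scheme \<Rightarrow> ('o, 'm, 'z) precat_scheme" where
  "opposite C = C\<lparr>Dom := Cod C, Cod := Dom C, Comp := \<lambda>g f. f \<cdot>\<^bsub>C\<^esub> g, Zero := \<lambda>A B. Zero C B A\<rparr>"

lemma opposite_simps:
  "Ob (opposite C) = Ob C" "Ar (opposite C) = Ar C" "Dom (opposite C) = Cod C"
  "Cod (opposite C) = Dom C" "Idt (opposite C) = Idt C" "Plus (opposite C) = Plus C"
  "g \<cdot>\<^bsub>opposite C\<^esub> f = f \<cdot>\<^bsub>C\<^esub> g" "Zero (opposite C) A B = Zero C B A"
  by (simp_all add: opposite_def)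

lemma Hom_opposite: "Hom (opposite C) A B = Hom C B A"
  by (auto simp: Hom_def opposite_simps)

lemma monic_opposite: "monic (opposite C) f \<longleftrightarrow> epic C f"
  by (simp add: monic_def epic_def opposite_simps Hom_opposite)

lemma preadditive_opposite:
  assumes "preadditive_category C"
  shows "preadditive_category (opposite C)"
proof -
  interpret preadditive_category C by fact
  have "hom_group (opposite C) A B = hom_group C B A" for A B
    by (simp add: hom_group_def Hom_opposite opposite_simps)
  then show ?thesis
    unfolding preadditive_category_def
    by (auto simp: Hom_opposite opposite_simps Dom_Ob Cod_Ob Idt_Hom Comp_Hom Comp_Idt_right
      Comp_Idt_left Hom_comm_group Comp_Plus_right Comp_Plus_left Comp_assoc)
qed

section \<open>Idempotents enveloping a kernel\<close>

text \<open>
  The idempotent \<open>e\<close> stands for the direct summand \<open>{x. e x = x}\<close> of \<open>M\<close>. That \<open>e\<close> fixes every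
  arrow killed by \<open>f\<close> says that the summand contains \<open>Ker f\<close>, and the last clause that \<open>Ker f\<close> is
  essential in it:
  a subobject \<open>x\<close> of the summand is \<open>0\<close> as soon as every arrow through \<open>x\<close> that \<open>f\<close> kills is zero,
  which says that \<open>x\<close> meets \<open>Ker f\<close> in \<open>0\<close>. In this form, by composition, zero arrows and
  monomorphisms alone, the notion can be read in the opposite category.
\<close>

definition kernel_envelope ::
  "('o, 'm, 'z) precat_scheme \<Rightarrow> 'o \<Rightarrow> 'o \<Rightarrow> 'm \<Rightarrow> 'm \<Rightarrow> bool" where
  "kernel_envelope C M N f e \<longleftrightarrow> e \<in> Hom C M M \<and> e \<cdot>\<^bsub>C\<^esub> e = e \<and>
     (\<forall>X. \<forall>b\<in>Hom C X M. f \<cdot>\<^bsub>C\<^esub> b = Zero C X N \<longrightarrow> e \<cdot>\<^bsub>C\<^esub> b = b) \<and>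
     (\<forall>X. \<forall>x\<in>Hom C X M. monic C x \<and> e \<cdot>\<^bsub>C\<^esub> x = x \<and>
        (\<forall>W. \<forall>b\<in>Hom C W X. f \<cdot>\<^bsub>C\<^esub> (x \<cdot>\<^bsub>C\<^esub> b) = Zero C W N \<longrightarrow> x \<cdot>\<^bsub>C\<^esub> b = Zero C W M)
        \<longrightarrow> x = Zero C X M)"

text \<open>
  Let \<open>d = 1 - g \<cdot> r\<close> be the projection onto \<open>Ker r\<close>. It is killed by \<open>s \<cdot> (f \<cdot> r)\<close>, hence
  \<open>e \<cdot> d = d\<close>. From this, \<open>e\<close> fixes \<open>g \<cdot> e'\<close> for \<open>e' = r \<cdot> (e \<cdot> g)\<close>, so \<open>g\<close> embeds the summand of \<open>e'\<close>
  into the summand of \<open>e\<close>. Idempotence of \<open>e'\<close> follows, and each test object for \<open>e'\<close> becomes a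
  test object for \<open>e\<close> after composition with the split monomorphism \<open>g\<close>. That \<open>s\<close> is monic gives
  back vanishing of \<open>f\<close> from vanishing of \<open>s \<cdot> f\<close>.
\<close>

lemma (in preadditive_category) kernel_envelope_descends:
  assumes r: "r \<in> Hom C M M'" and g: "g \<in> Hom C M' M" and rg: "r \<cdot> g = Idt C M'"
    and s: "s \<in> Hom C N' N" "monic C s" and f: "f \<in> Hom C M' N'"
    and env: "kernel_envelope C M N (s \<cdot> (f \<cdot> r)) e"
  shows "kernel_envelope C M' N' f (r \<cdot> (e \<cdot> g))"
proof -
  have e: "e \<in> Hom C M M" "e \<cdot> e = e"
    and fix_e: "\<And>X b. b \<in> Hom C X M \<Longrightarrow> s \<cdot> (f \<cdot> r) \<cdot> b = Zero C X N \<Longrightarrow> e \<cdot> b = b"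
    and ess: "\<And>X x. x \<in> Hom C X M \<Longrightarrow> monic C x \<Longrightarrow> e \<cdot> x = x \<Longrightarrow>
      (\<And>W b. b \<in> Hom C W X \<Longrightarrow> s \<cdot> (f \<cdot> r) \<cdot> (x \<cdot> b) = Zero C W N \<Longrightarrow> x \<cdot> b = Zero C W M)
      \<Longrightarrow> x = Zero C X M"
    using env unfolding kernel_envelope_def by blast+
  note [simp] = cat_simps
  have ob: "M \<in> Ob C" "M' \<in> Ob C" "N \<in> Ob C" "N' \<in> Ob C" using Hom_Ob r s by blast+
  have A: "r \<in> Ar C" "Dom C r = M" "Cod C r = M'" "g \<in> Ar C" "Dom C g = M'" "Cod C g = M"
    "s \<in> Ar C" "Dom C s = N'" "Cod C s = N" "f \<in> Ar C" "Dom C f = M'" "Cod C f = N'"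
    "e \<in> Ar C" "Dom C e = M" "Cod C e = M"
    using r g s f e by (auto simp: Hom_def)
  have rg': "r \<cdot> (g \<cdot> b) = b" if "b \<in> Ar C" "Cod C b = M'" for b
    using Comp_assoc_Ar[of b g r] rg A ob that by simp
  have ee': "e \<cdot> (e \<cdot> b) = e \<cdot> b" if "b \<in> Ar C" "Cod C b = M" for b
    using Comp_assoc_Ar[of b e e] e A that by simp
  \<comment> \<open>The projection onto \<open>Ker r\<close> along \<open>g\<close>.\<close>
  obtain d where d: "d \<in> Hom C M M" "Plus C (g \<cdot> r) d = Idt C M"
    using ex_summand[of "g \<cdot> r" M M "Idt C M"] Idt_Hom ob Comp_Hom r g by blast
  have dA: "d \<in> Ar C" "Dom C d = M" "Cod C d = M" using d by (auto simp: Hom_def)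
  have gr: "g \<cdot> r \<in> Hom C M M" using r g Comp_Hom by blast
  have split: "Plus C (g \<cdot> (r \<cdot> b)) (d \<cdot> b) = b" if b: "b \<in> Hom C X M" for X b
  proof -
    have bA: "b \<in> Ar C" "Cod C b = M" using b by (auto simp: Hom_def)
    show ?thesis using Comp_Plus_left[OF b gr d(1)] d(2) bA A ob by simp
  qed
  have rd: "r \<cdot> d = Zero C M M'"
  proof -
    have "Plus C (r \<cdot> (g \<cdot> r)) (r \<cdot> d) = r \<cdot> Idt C M"
      using Comp_Plus_right[OF gr d(1) r] d(2) by simp
    then have "Plus C r (r \<cdot> d) = r" using rg' A by simp
    then show ?thesis using Plus_eq_imp_Zero r d(1) Comp_Hom by blast
  qed
  have ed: "e \<cdot> d = d"
    using fix_e[OF d(1)] A dA rd ob by simp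
  have ed': "e \<cdot> (d \<cdot> b) = d \<cdot> b" if "b \<in> Ar C" "Cod C b = M" for b
    using Comp_assoc_Ar[of b d e] ed A dA that by simp
  have rd': "r \<cdot> (d \<cdot> b) = Zero C (Dom C b) M'" if "b \<in> Ar C" "Cod C b = M" for b
    using Comp_assoc_Ar[of b d r] rd A dA that ob by simp
  let ?e = "r \<cdot> (e \<cdot> g)"
  have eg: "e \<cdot> g \<in> Hom C M' M" using e g Comp_Hom by blast
  \<comment> \<open>Apply \<open>e\<close> to the decomposition of \<open>e \<cdot> g\<close> along \<open>Idt C M = g \<cdot> r + d\<close>:
      the \<open>d\<close>-part is fixed, hence so is the other part.\<close>
  have ege: "e \<cdot> (g \<cdot> ?e) = g \<cdot> ?e"
  proof -
    have 1: "g \<cdot> ?e \<in> Hom C M' M" "d \<cdot> (e \<cdot> g) \<in> Hom C M' M"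
      using Comp_Hom eg r g d by blast+
    have "Plus C (e \<cdot> (g \<cdot> ?e)) (e \<cdot> (d \<cdot> (e \<cdot> g))) = e \<cdot> (e \<cdot> g)"
      using Comp_Plus_right[OF 1 e(1)] split[OF eg] by simp
    moreover have "e \<cdot> (d \<cdot> (e \<cdot> g)) = d \<cdot> (e \<cdot> g)" "e \<cdot> (e \<cdot> g) = e \<cdot> g"
      using ed' ee' A by simp_all
    ultimately have "Plus C (d \<cdot> (e \<cdot> g)) (e \<cdot> (g \<cdot> ?e)) = Plus C (d \<cdot> (e \<cdot> g)) (g \<cdot> ?e)"
      using split[OF eg] Plus_commute[OF 1] Plus_commute[OF Comp_Hom[OF 1(1) e(1)] 1(2)] by argo
    then show ?thesis using Plus_cancel_left 1 e(1) Comp_Hom by blast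
  qed
  have egx: "e \<cdot> (g \<cdot> x) = g \<cdot> x" if "?e \<cdot> x = x" "x \<in> Ar C" "Cod C x = M'" for x
  proof -
    have "e \<cdot> (g \<cdot> ?e) \<cdot> x = g \<cdot> ?e \<cdot> x" using ege by simp
    moreover have "g \<cdot> ?e \<cdot> x = g \<cdot> (?e \<cdot> x)" "e \<cdot> (g \<cdot> ?e) \<cdot> x = e \<cdot> (g \<cdot> (?e \<cdot> x))"
      using that A by simp_all
    ultimately show ?thesis using that by simp
  qed
  have idem: "?e \<cdot> ?e = ?e"
  proof -
    have "r \<cdot> (e \<cdot> (g \<cdot> ?e)) = r \<cdot> (g \<cdot> ?e)" using ege by simp
    then show ?thesis using A rg' by simp
  qed
  have "?e \<cdot> b = b" if b: "b \<in> Hom C X M'" "f \<cdot> b = Zero C X N'" for X b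
  proof -
    have bA: "b \<in> Ar C" "Dom C b = X" "Cod C b = M'" using b by (auto simp: Hom_def)
    have "s \<cdot> (f \<cdot> r) \<cdot> (g \<cdot> b) = Zero C X N" using A bA rg' b(2) ob bA Dom_Ob by auto
    then have "e \<cdot> (g \<cdot> b) = g \<cdot> b" using fix_e Comp_Hom b g by blast
    then show ?thesis using A bA rg' by simp
  qed
  moreover have "x = Zero C X M'"
    if x: "x \<in> Hom C X M'" "monic C x" "?e \<cdot> x = x"
      and z: "\<And>W b. b \<in> Hom C W X \<Longrightarrow> f \<cdot> (x \<cdot> b) = Zero C W N' \<Longrightarrow> x \<cdot> b = Zero C W M'" for X x
  proof -
    have xA: "x \<in> Ar C" "Dom C x = X" "Cod C x = M'" "X \<in> Ob C"
      using x Hom_Ob by (auto simp: Hom_def)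
    have "monic C g" using monic_left_inverse g r rg by blast
    then have "monic C (g \<cdot> x)" using monic_Comp x A xA by simp
    moreover have "e \<cdot> (g \<cdot> x) = g \<cdot> x" using egx x xA by blast
    moreover have "g \<cdot> x \<cdot> b = Zero C W M"
      if b: "b \<in> Hom C W X" "s \<cdot> (f \<cdot> r) \<cdot> (g \<cdot> x \<cdot> b) = Zero C W N" for W b
    proof -
      have bA: "b \<in> Ar C" "Dom C b = W" "Cod C b = X" "W \<in> Ob C"
        using b Hom_Ob by (auto simp: Hom_def)
      have "s \<cdot> (f \<cdot> (x \<cdot> b)) = Zero C W N" using b(2) A xA bA rg' by simp
      then have "f \<cdot> (x \<cdot> b) = Zero C W N'"
        using monic_zero_cancel[OF s(2), of "f \<cdot> (x \<cdot> b)"] A xA bA by simp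
      then have "x \<cdot> b = Zero C W M'" using z b(1) by blast
      then show ?thesis using A xA bA by simp
    qed
    ultimately have "g \<cdot> x = Zero C X M" using ess[of "g \<cdot> x"] x g Comp_Hom by blast
    then have "r \<cdot> (g \<cdot> x) = Zero C X M'" using A xA by simp
    then show ?thesis using rg' xA by simp
  qed
  moreover have "?e \<in> Hom C M' M'" using eg r Comp_Hom by blast
  ultimately show ?thesis unfolding kernel_envelope_def using idem by blast
qed

section \<open>Splitting idempotents\<close>

context preadditive_category
begin

lemma complement_idempotent:
  assumes e: "e \<in> Hom C M M" "e \<cdot> e = e" and d: "d \<in> Hom C M M" "Plus C e d = Idt C M"
  shows "e \<cdot> d = Zero C M M" "d \<cdot> e = Zero C M M" "d \<cdot> d = d"
proof -
  have M: "M \<in> Ob C" using e Hom_Ob by blast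
  have "Plus C (e \<cdot> e) (e \<cdot> d) = e \<cdot> Idt C M" "Plus C (e \<cdot> e) (d \<cdot> e) = Idt C M \<cdot> e"
    using Comp_Plus_right[OF e(1) d(1) e(1)] Comp_Plus_left[OF e(1) e(1) d(1)] d(2) by simp_all
  then have "Plus C e (e \<cdot> d) = e" "Plus C e (d \<cdot> e) = e"
    using e Comp_Idt_right Comp_Idt_left by simp_all
  then show ed: "e \<cdot> d = Zero C M M" "d \<cdot> e = Zero C M M"
    using Plus_eq_imp_Zero e(1) d(1) Comp_Hom by blast+
  have "Plus C (e \<cdot> d) (d \<cdot> d) = Idt C M \<cdot> d"
    using Comp_Plus_left[OF d(1) e(1) d(1)] d(2) by simp
  then show "d \<cdot> d = d" using ed Plus_Zero Comp_Hom d(1) Comp_Idt_left by metis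
qed

lemma biproduct_decomposition:
  assumes "is_biproduct C K B M u v p q" "b \<in> Hom C X M"
  shows "Plus C (u \<cdot> (p \<cdot> b)) (v \<cdot> (q \<cdot> b)) = b"
proof -
  have h: "u \<in> Hom C K M" "v \<in> Hom C B M" "p \<in> Hom C M K" "q \<in> Hom C M B"
    and s: "Plus C (u \<cdot> p) (v \<cdot> q) = Idt C M"
    using assms by (auto simp: is_biproduct_def)
  have "Plus C (u \<cdot> p \<cdot> b) (v \<cdot> q \<cdot> b) = Idt C M \<cdot> b"
    using Comp_Plus_left[OF assms(2) Comp_Hom[OF h(3,1)] Comp_Hom[OF h(4,2)]] s by simp
  then show ?thesis
    using Comp_assoc[OF assms(2) h(3,1)] Comp_assoc[OF assms(2) h(4,2)] Comp_Idt_left[OF assms(2)] by simp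
qed

lemma biproduct_codecomposition:
  assumes "is_biproduct C K B M u v p q" "z \<in> Hom C M X"
  shows "Plus C (z \<cdot> u \<cdot> p) (z \<cdot> v \<cdot> q) = z"
proof -
  have h: "u \<in> Hom C K M" "v \<in> Hom C B M" "p \<in> Hom C M K" "q \<in> Hom C M B"
    and s: "Plus C (u \<cdot> p) (v \<cdot> q) = Idt C M"
    using assms by (auto simp: is_biproduct_def)
  have "Plus C (z \<cdot> (u \<cdot> p)) (z \<cdot> (v \<cdot> q)) = z \<cdot> Idt C M"
    using Comp_Plus_right[OF Comp_Hom[OF h(3,1)] Comp_Hom[OF h(4,2)] assms(2)] s by simp
  then show ?thesis
    using Comp_assoc[OF h(3,1) assms(2)] Comp_assoc[OF h(4,2) assms(2)] Comp_Idt_right[OF assms(2)] by simp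
qed

lemma biproduct_cokernel:
  assumes "is_biproduct C K B M u v p q"
  shows "is_cokernel C u q"
  unfolding is_cokernel_def
proof (intro conjI allI ballI impI)
  have h: "u \<in> Hom C K M" "v \<in> Hom C B M" "p \<in> Hom C M K" "q \<in> Hom C M B"
    and s: "q \<cdot> v = Idt C B" "q \<cdot> u = Zero C K B"
    using assms by (auto simp: is_biproduct_def)
  have ob: "K \<in> Ob C" "B \<in> Ob C" "M \<in> Ob C" using h Hom_Ob by blast+
  show "u \<in> Ar C" "q \<in> Ar C" "Dom C q = Cod C u" "q \<cdot> u = Zero C (Dom C u) (Cod C q)"
    using h s by (auto simp: Hom_def)
  fix X z
  assume "z \<in> Hom C (Cod C u) X" "z \<cdot> u = Zero C (Dom C u) X"
  then have z: "z \<in> Hom C M X" "z \<cdot> u = Zero C K X" using h by (auto simp: Hom_def)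
  have "z \<cdot> u \<cdot> p = Zero C M X"
    using z h Comp_Zero_left Hom_Ob by (auto simp: Hom_def dest: Cod_Ob)
  moreover have "z \<cdot> v \<cdot> q \<in> Hom C M X" using z h Comp_Hom by blast
  ultimately have "z \<cdot> v \<cdot> q = z" using biproduct_codecomposition[OF assms z(1)] Plus_Zero by metis
  moreover have "a = z \<cdot> v" if "a \<in> Hom C B X" "a \<cdot> q = z" for a
  proof -
    have "a \<cdot> q \<cdot> v = a \<cdot> (q \<cdot> v)" using Comp_assoc h that by blast
    then show ?thesis using s that Comp_Idt_right by simp
  qed
  ultimately show "\<exists>!a. a \<in> Hom C (Cod C q) X \<and> a \<cdot> q = z"
    using h z Comp_Hom by (intro ex1I[of _ "z \<cdot> v"]) (auto simp: Hom_def cat_simps)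
qed

end

context abelian_category
begin

text \<open>
  The image of \<open>e\<close> is the kernel of the complementary idempotent \<open>d = 1 - e\<close>, through which \<open>e\<close> factors
  since \<open>d \<cdot> e = 0\<close>.
\<close>

lemma idempotent_splits:
  assumes e: "e \<in> Hom C M M" "e \<cdot> e = e" and d: "d \<in> Hom C M M" "Plus C e d = Idt C M"
  shows "\<exists>K u p. u \<in> Hom C K M \<and> p \<in> Hom C M K \<and> u \<cdot> p = e \<and> p \<cdot> u = Idt C K"
proof -
  note z = complement_idempotent[OF assms]
  obtain u where u: "is_kernel C d u" using ex_kernel d by (auto simp: Hom_def)
  note uH = kernel_HomD[OF u d(1)]
  obtain p where p: "p \<in> Hom C M (Dom C u)" "u \<cdot> p = e" using kernel_factor[OF u d(1) e(1) z(2)] by blast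
  have "Plus C (e \<cdot> u) (d \<cdot> u) = Idt C M \<cdot> u" using Comp_Plus_left[OF uH(1) e(1) d(1)] d(2) by simp
  then have "e \<cdot> u = u" using uH Plus_Zero Comp_Hom e(1) Comp_Idt_left by metis
  then have "u \<cdot> (p \<cdot> u) = u \<cdot> Idt C (Dom C u)"
    using p uH Comp_assoc Comp_Idt_right by metis
  then have "p \<cdot> u = Idt C (Dom C u)"
    by - (rule monic_cancel[OF kernel_monic[OF u]];
      use p uH Hom_Ob[OF uH(1)] in \<open>auto simp: Hom_def cat_simps\<close>)
  then show ?thesis using p uH by blast
qed

lemma idempotent_biproduct:
  assumes e: "e \<in> Hom C M M" "e \<cdot> e = e" and d: "d \<in> Hom C M M" "Plus C e d = Idt C M"
  shows "\<exists>K B u v p q. is_biproduct C K B M u v p q \<and> u \<cdot> p = e \<and> v \<cdot> q = d"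
proof -
  note z = complement_idempotent[OF assms]
  obtain K u p where u: "u \<in> Hom C K M" "p \<in> Hom C M K" "u \<cdot> p = e" "p \<cdot> u = Idt C K"
    using idempotent_splits[OF assms] by blast
  have "Plus C d e = Idt C M" using d e Plus_commute by metis
  then obtain B v q where v: "v \<in> Hom C B M" "q \<in> Hom C M B" "v \<cdot> q = d" "q \<cdot> v = Idt C B"
    using idempotent_splits[OF d(1) z(3) e(1)] by blast
  have ob: "K \<in> Ob C" "B \<in> Ob C" "M \<in> Ob C" using u v Hom_Ob by blast+
  have A: "u \<in> Ar C" "Dom C u = K" "Cod C u = M" "p \<in> Ar C" "Dom C p = M" "Cod C p = K"
    "v \<in> Ar C" "Dom C v = B" "Cod C v = M" "q \<in> Ar C" "Dom C q = M" "Cod C q = B"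
    using u v by (auto simp: Hom_def)
  \<comment> \<open>The inclusion of each half followed by the projection to the other vanishes because
      \<open>e \<cdot> d = 0\<close> and \<open>d \<cdot> e = 0\<close>; both cases are instances of one computation.\<close>
  have orth: "p' \<cdot> v' = Zero C B' K'"
    if h: "u' \<in> Hom C K' M" "p' \<in> Hom C M K'" "p' \<cdot> u' = Idt C K'"
      "v' \<in> Hom C B' M" "q' \<in> Hom C M B'" "q' \<cdot> v' = Idt C B'"
      "(u' \<cdot> p') \<cdot> (v' \<cdot> q') = Zero C M M" for K' B' u' p' v' q'
  proof -
    have ob': "K' \<in> Ob C" "B' \<in> Ob C" using h Hom_Ob by blast+
    have A': "u' \<in> Ar C" "Dom C u' = K'" "Cod C u' = M" "p' \<in> Ar C" "Dom C p' = M" "Cod C p' = K'"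
      "v' \<in> Ar C" "Dom C v' = B'" "Cod C v' = M" "q' \<in> Ar C" "Dom C q' = M" "Cod C q' = B'"
      using h by (auto simp: Hom_def)
    have "p' \<cdot> v' = (p' \<cdot> u') \<cdot> (p' \<cdot> v') \<cdot> (q' \<cdot> v')" using h(3,6) A' ob' by (simp add: cat_simps)
    also have "\<dots> = p' \<cdot> ((u' \<cdot> p') \<cdot> (v' \<cdot> q')) \<cdot> v'" using A' ob' by (simp add: cat_simps)
    also have "\<dots> = Zero C B' K'" unfolding h(7) using A' ob' ob by (simp add: cat_simps)
    finally show ?thesis .
  qed
  have "p \<cdot> v = Zero C B K" "q \<cdot> u = Zero C K B"
    using orth[of u K p v B q] orth[of v B q u K p] u v z by auto
  then have "is_biproduct C K B M u v p q" unfolding is_biproduct_def using u v d(2) by simp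
  then show ?thesis using u v by blast
qed

section \<open>Essential and superfluous subobjects\<close>

text \<open>
  The arrows that factor through both \<open>h\<close> and \<open>x\<close> are those that factor through \<open>h \<inter> x\<close>. So the
  intersection is \<open>0\<close> if and only if every such common arrow \<open>h \<cdot> a = x \<cdot> b\<close> is zero. The common arrow
  need not be monic, so it is compared with the intersection through the pullback of \<open>h\<close> along \<open>x\<close>, which
  is available because \<open>h\<close> is a kernel.
\<close>

lemma essential_in_iff:
  assumes h: "subobject C h L"
  shows "essential_in C h L \<longleftrightarrow> (\<forall>X. \<forall>x\<in>Hom C X L. monic C x \<and>
    (\<forall>W. \<forall>a\<in>Hom C W (Dom C h). \<forall>b\<in>Hom C W X. h \<cdot> a = x \<cdot> b \<longrightarrow> x \<cdot> b = Zero C W L)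
    \<longrightarrow> x = Zero C X L)"
proof -
  have hm: "monic C h" and hH: "h \<in> Hom C (Dom C h) L" using h monic_Ar by (auto simp: subobject_def Hom_def)
  obtain z where z: "is_kernel C z h" using monic_normal[OF hm] by blast
  then have zH: "z \<in> Hom C L (Cod C z)" using hH by (auto simp: is_kernel_def Hom_def)
  have key: "(\<exists>i. is_intersection C L h x i \<and> zero_object C (Dom C i)) \<longleftrightarrow>
    (\<forall>W. \<forall>a\<in>Hom C W (Dom C h). \<forall>b\<in>Hom C W X. h \<cdot> a = x \<cdot> b \<longrightarrow> x \<cdot> b = Zero C W L)"
    (is "?I \<longleftrightarrow> ?Z") if x: "x \<in> Hom C X L" "monic C x" for X x
  proof
    have ob: "X \<in> Ob C" "L \<in> Ob C" using x Hom_Ob by blast+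
    have DX: "Dom C x = X" "Cod C x = L" "x \<in> Ar C" using x by (auto simp: Hom_def)
    show ?Z if int: ?I
    proof (intro allI ballI impI)
      obtain i where i: "is_intersection C L h x i" "zero_object C (Dom C i)" using int by blast
      fix W a b assume ab: "a \<in> Hom C W (Dom C h)" "b \<in> Hom C W X" "h \<cdot> a = x \<cdot> b"
      have W: "W \<in> Ob C" using ab Hom_Ob by blast
      \<comment> \<open>The pullback of \<open>h\<close> along \<open>x\<close> is the kernel of \<open>z \<cdot> x\<close>.\<close>
      have zx: "z \<cdot> x \<in> Hom C X (Cod C z)" using zH x Comp_Hom by blast
      then obtain k where k: "is_kernel C (z \<cdot> x) k" using ex_kernel by (auto simp: Hom_def)
      note kH = kernel_HomD[OF k zx]
      have xk: "x \<cdot> k \<in> Hom C (Dom C k) L" using x kH Comp_Hom by blast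
      have "z \<cdot> (x \<cdot> k) = Zero C (Dom C k) (Cod C z)" using kH Comp_assoc x zH by metis
      then obtain t where t: "t \<in> Hom C (Dom C k) (Dom C h)" "h \<cdot> t = x \<cdot> k"
        using kernel_factor[OF z zH xk] by blast
      have "subobject C (x \<cdot> k) L" "Dom C (x \<cdot> k) = Dom C k"
        unfolding subobject_def using monic_Comp[OF kernel_monic[OF k] x(2)] kH x xk by (auto simp: Hom_def)
      then have "sub_le C (x \<cdot> k) i"
        using i(1) t kH x DX unfolding is_intersection_def sub_le_def by metis
      then obtain j where j: "j \<in> Hom C (Dom C k) (Dom C i)" "i \<cdot> j = x \<cdot> k"
        unfolding sub_le_def using \<open>Dom C (x \<cdot> k) = Dom C k\<close> by auto
      have iH: "i \<in> Hom C (Dom C i) L"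
        using i(1) monic_Ar by (auto simp: is_intersection_def subobject_def Hom_def)
      have "i = Zero C (Dom C i) L" using zero_object_arrow[OF i(2)] iH by (auto simp: Hom_def)
      then have xk0: "x \<cdot> k = Zero C (Dom C k) L"
        using j Comp_Zero_left[of j "Dom C i" L] ob by (auto simp: Hom_def)
      have "z \<cdot> x \<cdot> b = Zero C W (Cod C z)"
      proof -
        have "z \<cdot> x \<cdot> b = z \<cdot> h \<cdot> a" using Comp_assoc ab x zH hH by metis
        then show ?thesis
          using kernel_HomD[OF z zH] Comp_Zero_left[of a "Dom C h" "Cod C z"] ab Hom_Ob[OF zH]
          by (auto simp: Hom_def)
      qed
      then obtain b' where b': "b' \<in> Hom C W (Dom C k)" "k \<cdot> b' = b"
        using kernel_factor[OF k zx ab(2)] by blast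
      have "x \<cdot> b = x \<cdot> k \<cdot> b'" using b' Comp_assoc kH x by metis
      then show "x \<cdot> b = Zero C W L"
        using xk0 b' ob Comp_Zero_left[of b' "Dom C k" L] by (auto simp: Hom_def)
    qed
    show ?I if Z: ?Z
    proof -
      \<comment> \<open>The zero subobject is the intersection.\<close>
      obtain O' where O': "zero_object C O'" using ex_zero_object by blast
      then have O: "O' \<in> Ob C" by (simp add: zero_object_def)
      let ?i = "Zero C O' L"
      have iA: "?i \<in> Hom C O' L" "Dom C ?i = O'" "Cod C ?i = L" using O ob Zero_Ar Zero_Hom by simp_all
      have "monic C ?i"
      proof (rule monic_if_zero_cancel[OF iA(1)])
        fix Y w assume "w \<in> Hom C Y O'"
        then show "w = Zero C Y O'" using O' Zero_Hom[OF _ O, of Y] Hom_Ob[of w Y O']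
          unfolding zero_object_def by blast
      qed
      moreover have "sub_le C ?i h" "sub_le C ?i x"
        unfolding sub_le_def iA using Zero_Hom[OF O] Comp_Zero_right[of h "Dom C h" O']
          Comp_Zero_right[of x X O'] hH ob O DX Hom_Ob[OF hH] by (force simp: Hom_def)+
      moreover have "sub_le C j ?i" if j: "subobject C j L" "sub_le C j h" "sub_le C j x" for j
      proof -
        have jA: "j \<in> Ar C" "Cod C j = L" using j monic_Ar by (auto simp: subobject_def)
        have "j = Zero C (Dom C j) L" using Z j(2,3) unfolding sub_le_def DX by metis
        then have "Zero C O' L \<cdot> Zero C (Dom C j) O' = j"
          using Comp_Zero_left[of "Zero C (Dom C j) O'" O' L] Zero_Ar O ob jA Dom_Ob by simp
        then show ?thesis unfolding sub_le_def iA using Zero_Hom O jA Dom_Ob by blast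
      qed
      ultimately have "is_intersection C L h x ?i"
        unfolding is_intersection_def subobject_def using iA by blast
      then show ?thesis using iA O' by metis
    qed
  qed
  have sub: "subobject C x L \<longleftrightarrow> x \<in> Hom C (Dom C x) L \<and> monic C x" for x
    using monic_Ar by (auto simp: subobject_def Hom_def)
  have z: "zero_object C (Dom C x) \<longleftrightarrow> x = Zero C X L" if "x \<in> Hom C X L" "monic C x" for x X
    using monic_zero_object_iff[OF that(2)] that by (auto simp: Hom_def)
  show ?thesis
  proof
    assume "essential_in C h L"
    then have E: "\<And>x. subobject C x L \<Longrightarrow> (\<exists>i. is_intersection C L h x i \<and> zero_object C (Dom C i)) \<Longrightarrow>
      zero_object C (Dom C x)"
      unfolding essential_in_def by blast
    show "\<forall>X. \<forall>x\<in>Hom C X L. monic C x \<and>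
      (\<forall>W. \<forall>a\<in>Hom C W (Dom C h). \<forall>b\<in>Hom C W X. h \<cdot> a = x \<cdot> b \<longrightarrow> x \<cdot> b = Zero C W L)
      \<longrightarrow> x = Zero C X L"
    proof (intro allI ballI impI, elim conjE)
      fix X x assume x: "x \<in> Hom C X L" "monic C x"
        "\<forall>W. \<forall>a\<in>Hom C W (Dom C h). \<forall>b\<in>Hom C W X. h \<cdot> a = x \<cdot> b \<longrightarrow> x \<cdot> b = Zero C W L"
      have "subobject C x L" using x by (simp add: subobject_def Hom_def)
      then have "zero_object C (Dom C x)" using E key[OF x(1,2)] x(3) by blast
      then show "x = Zero C X L" using z[OF x(1,2)] by simp
    qed
  next
    assume R: "\<forall>X. \<forall>x\<in>Hom C X L. monic C x \<and>
      (\<forall>W. \<forall>a\<in>Hom C W (Dom C h). \<forall>b\<in>Hom C W X. h \<cdot> a = x \<cdot> b \<longrightarrow> x \<cdot> b = Zero C W L)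
      \<longrightarrow> x = Zero C X L"
    show "essential_in C h L"
      unfolding essential_in_def
    proof (intro conjI allI impI)
      fix x assume s: "subobject C x L" and i: "\<exists>i. is_intersection C L h x i \<and> zero_object C (Dom C i)"
      have x: "x \<in> Hom C (Dom C x) L" "monic C x" using s sub by blast+
      have "x = Zero C (Dom C x) L" using R x i key[OF x] by blast
      then show "zero_object C (Dom C x)" using z[OF x] by blast
    qed (rule h)
  qed
qed

text \<open>
  A monomorphism is the kernel of some \<open>g\<close>, and \<open>g\<close> factors through the cokernel \<open>y\<close>. If \<open>y = 0\<close>
  then \<open>g = 0\<close>, so the identity factors through the kernel of \<open>g\<close>.
\<close>

lemma monic_zero_cokernel_iso:
  assumes x: "x \<in> Hom C X L" "monic C x" and y: "is_cokernel C x y" "y = Zero C L (Cod C y)"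
  shows "is_iso C x"
proof -
  obtain g where g: "is_kernel C g x" using monic_normal[OF x(2)] by blast
  then have gH: "g \<in> Hom C L (Cod C g)" using x by (auto simp: is_kernel_def Hom_def)
  have ob: "X \<in> Ob C" "L \<in> Ob C" "Cod C g \<in> Ob C" using x gH Hom_Ob by blast+
  have DX: "Dom C x = X" "Cod C x = L" "x \<in> Ar C" using x by (auto simp: Hom_def)
  obtain b where b: "b \<in> Hom C (Cod C y) (Cod C g)" "b \<cdot> y = g"
    using cokernel_factor[OF y(1) x(1) gH] kernel_HomD[OF g gH] DX by auto
  then have "g = Zero C L (Cod C g)"
    using Comp_Zero_right[of b "Cod C y" L] y(2) ob by (auto simp: Hom_def)
  then have "g \<cdot> Idt C L = Zero C L (Cod C g)" using gH Comp_Idt_right by simp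
  then obtain h where h: "h \<in> Hom C L X" "x \<cdot> h = Idt C L"
    using kernel_factor[OF g gH Idt_Hom[OF ob(2)]] DX by auto
  have "x \<cdot> (h \<cdot> x) = Idt C L \<cdot> x" using Comp_assoc h x by metis
  then have "x \<cdot> (h \<cdot> x) = x \<cdot> Idt C X" using Comp_Idt_left Comp_Idt_right x by simp
  then have "h \<cdot> x = Idt C X"
    by - (rule monic_cancel[OF x(2)]; use h DX ob in \<open>auto simp: Hom_def cat_simps\<close>)
  then show ?thesis unfolding is_iso_def using h DX by auto
qed

lemma iso_zero_cancel:
  assumes "is_iso C t" "z \<in> Hom C (Cod C t) X" "z \<cdot> t = Zero C (Dom C t) X"
  shows "z = Zero C (Cod C t) X"
proof -
  obtain g where g: "g \<in> Hom C (Cod C t) (Dom C t)" "t \<cdot> g = Idt C (Cod C t)"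
    and t: "t \<in> Hom C (Dom C t) (Cod C t)"
    using assms(1) by (auto simp: is_iso_def Hom_def)
  have "z = z \<cdot> t \<cdot> g" using g Comp_assoc[OF g(1) t assms(2)] Comp_Idt_right[OF assms(2)] by simp
  then show ?thesis using assms(3) Comp_Zero_left[of g "Dom C t" X] g Hom_Ob[OF assms(2)]
    by (auto simp: Hom_def)
qed

text \<open>
  The kernel of an arrow that kills \<open>j\<close> and \<open>x\<close> contains their sum; conversely every subobject that
  contains \<open>j\<close> and \<open>x\<close> is the kernel of such an arrow. Hence \<open>j + x = L\<close> says that only zero arrows
  kill both.
\<close>

lemma sum_iso_iff:
  assumes j: "j \<in> Hom C J L" and x: "x \<in> Hom C X L"
  shows "(\<exists>t. is_sum C L j x t \<and> is_iso C t) \<longleftrightarrow>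
    (\<forall>Z. \<forall>z\<in>Hom C L Z. z \<cdot> j = Zero C J Z \<and> z \<cdot> x = Zero C X Z \<longrightarrow> z = Zero C L Z)"
proof
  have D: "Dom C j = J" "Dom C x = X" "Cod C j = L" "Cod C x = L" using j x by (auto simp: Hom_def)
  have L: "L \<in> Ob C" using j Hom_Ob by blast
  assume "\<exists>t. is_sum C L j x t \<and> is_iso C t"
  then obtain t where t: "is_sum C L j x t" "is_iso C t" by blast
  have tH: "t \<in> Hom C (Dom C t) L"
    using t(1) monic_Ar by (auto simp: is_sum_def subobject_def Hom_def)
  then have tC: "Cod C t = L" by (simp add: Hom_def)
  show "\<forall>Z. \<forall>z\<in>Hom C L Z. z \<cdot> j = Zero C J Z \<and> z \<cdot> x = Zero C X Z \<longrightarrow> z = Zero C L Z"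
  proof (intro allI ballI impI, elim conjE)
    fix Z z assume z: "z \<in> Hom C L Z" "z \<cdot> j = Zero C J Z" "z \<cdot> x = Zero C X Z"
    obtain w where w: "is_kernel C z w" using ex_kernel z by (auto simp: Hom_def)
    note wH = kernel_HomD[OF w z(1)]
    have "subobject C w L" using kernel_monic[OF w] wH by (auto simp: subobject_def Hom_def)
    moreover have "sub_le C j w" "sub_le C x w"
      unfolding sub_le_def D using kernel_factor[OF w z(1)] j x z by blast+
    ultimately have "sub_le C t w" using t(1) unfolding is_sum_def by blast
    then obtain a where a: "a \<in> Hom C (Dom C t) (Dom C w)" "w \<cdot> a = t" unfolding sub_le_def by blast
    have "z \<cdot> t = z \<cdot> w \<cdot> a" using a Comp_assoc wH z(1) by metis
    then have "z \<cdot> t = Zero C (Dom C t) Z"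
      using wH a Comp_Zero_left[of a "Dom C w" Z] Hom_Ob[OF z(1)] by (auto simp: Hom_def)
    then show "z = Zero C L Z" using iso_zero_cancel[OF t(2)] z(1) tC by simp
  qed
next
  have D: "Dom C j = J" "Dom C x = X" "Cod C j = L" "Cod C x = L" using j x by (auto simp: Hom_def)
  have L: "L \<in> Ob C" using j Hom_Ob by blast
  assume Z: "\<forall>Z. \<forall>z\<in>Hom C L Z. z \<cdot> j = Zero C J Z \<and> z \<cdot> x = Zero C X Z \<longrightarrow> z = Zero C L Z"
  let ?t = "Idt C L"
  have tH: "?t \<in> Hom C L L" "Dom C ?t = L" "Cod C ?t = L" using Idt_Ar Idt_Hom L by simp_all
  have "monic C ?t" using monic_left_inverse[of ?t L L ?t] tH Comp_Idt_left by blast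
  moreover have "sub_le C j ?t" "sub_le C x ?t"
    unfolding sub_le_def D tH using j x Comp_Idt_left by blast+
  moreover have "sub_le C ?t m" if m: "subobject C m L" "sub_le C j m" "sub_le C x m" for m
  proof -
    have mm: "monic C m" "m \<in> Hom C (Dom C m) L"
      using m monic_Ar by (auto simp: subobject_def Hom_def)
    obtain z where z: "is_kernel C z m" using monic_normal mm by blast
    then have zH: "z \<in> Hom C L (Cod C z)" using mm by (auto simp: is_kernel_def Hom_def)
    have kill: "z \<cdot> a = Zero C A (Cod C z)" if a: "a \<in> Hom C A L" "sub_le C a m" for A a
    proof -
      have "Dom C a = A" using a by (simp add: Hom_def)
      then obtain b where b: "b \<in> Hom C A (Dom C m)" "m \<cdot> b = a" using a unfolding sub_le_def by blast
      have "z \<cdot> a = z \<cdot> m \<cdot> b" using b Comp_assoc mm zH by metis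
      then show ?thesis using kernel_HomD[OF z zH] b Comp_Zero_left[of b "Dom C m" "Cod C z"] Hom_Ob[OF zH]
        by (auto simp: Hom_def)
    qed
    have "z = Zero C L (Cod C z)" using Z zH kill j x m by blast
    then have "z \<cdot> ?t = Zero C L (Cod C z)" using Comp_Idt_right[OF zH] by simp
    then show ?thesis unfolding sub_le_def tH using kernel_factor[OF z zH tH(1)] by blast
  qed
  ultimately have "is_sum C L j x ?t" unfolding is_sum_def subobject_def using tH by blast
  moreover have "is_iso C ?t" unfolding is_iso_def tH
    using tH Idt_Ar[OF L] Comp_Idt_left[OF tH(1)] by blast
  ultimately show "\<exists>t. is_sum C L j x t \<and> is_iso C t" by blast
qed

text \<open>
  The dual of the description of essential subobjects: a subobject \<open>x\<close> of \<open>L\<close> is replaced by the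
  quotient \<open>y : L \<rightarrow> L/x\<close>, and ``\<open>x = L\<close>'' by ``\<open>y = 0\<close>''. The arrows that kill \<open>x\<close> are the \<open>b \<cdot> y\<close>, so
  the premise on \<open>y\<close> is the condition for \<open>j + x = L\<close>.
\<close>

lemma superfluous_in_iff:
  assumes "subobject C j L"
  shows "superfluous_in C j L \<longleftrightarrow> (\<forall>Y. \<forall>y\<in>Hom C L Y. epic C y \<and>
    (\<forall>Z. \<forall>b\<in>Hom C Y Z. b \<cdot> y \<cdot> j = Zero C (Dom C j) Z \<longrightarrow> b \<cdot> y = Zero C L Z)
    \<longrightarrow> y = Zero C L Y)" (is "_ \<longleftrightarrow> ?R")
proof
  have j: "j \<in> Hom C (Dom C j) L" using assms monic_Ar by (auto simp: subobject_def Hom_def)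
  assume S: "superfluous_in C j L"
  show ?R
  proof (intro allI ballI impI, elim conjE)
    fix Y y assume y: "y \<in> Hom C L Y" "epic C y"
      and Z: "\<forall>Z. \<forall>b\<in>Hom C Y Z. b \<cdot> y \<cdot> j = Zero C (Dom C j) Z \<longrightarrow> b \<cdot> y = Zero C L Z"
    have Y: "Y \<in> Ob C" "L \<in> Ob C" using y Hom_Ob by blast+
    obtain g where g: "is_cokernel C g y" using epic_conormal[OF y(2)] by blast
    then have gH: "g \<in> Hom C (Dom C g) L" and yY: "Cod C y = Y"
      using y by (auto simp: is_cokernel_def Hom_def)
    obtain x where x: "is_kernel C y x" using ex_kernel y by (auto simp: Hom_def)
    note xH = kernel_HomD[OF x y(1)]
    obtain g' where g': "g' \<in> Hom C (Dom C g) (Dom C x)" "x \<cdot> g' = g"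
      using kernel_factor[OF x y(1) gH] cokernel_HomD[OF g gH] yY by auto
    have "z = Zero C L Z"
      if z: "z \<in> Hom C L Z" "z \<cdot> j = Zero C (Dom C j) Z" "z \<cdot> x = Zero C (Dom C x) Z" for Z z
    proof -
      have "z \<cdot> g = z \<cdot> x \<cdot> g'" using g' Comp_assoc xH z by metis
      then have "z \<cdot> g = Zero C (Dom C g) Z"
        using z g' Comp_Zero_left[of g' "Dom C x" Z] Hom_Ob[OF z(1)] by (auto simp: Hom_def)
      then obtain b where "b \<in> Hom C Y Z" "b \<cdot> y = z" using cokernel_factor[OF g gH z(1)] yY by auto
      then show ?thesis using Z z by blast
    qed
    then have "\<exists>t. is_sum C L j x t \<and> is_iso C t" using sum_iso_iff[OF j xH(1)] by blast
    moreover have "subobject C x L" using kernel_monic[OF x] xH by (auto simp: subobject_def Hom_def)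
    ultimately have "is_iso C x" using S unfolding superfluous_in_def by blast
    then show "y = Zero C L Y" using iso_zero_cancel[of x y Y] xH y by (auto simp: Hom_def)
  qed
next
  have j: "j \<in> Hom C (Dom C j) L" using assms monic_Ar by (auto simp: subobject_def Hom_def)
  assume R: ?R
  show "superfluous_in C j L"
    unfolding superfluous_in_def
  proof (intro conjI allI impI)
    fix x assume s: "subobject C x L" and t: "\<exists>t. is_sum C L j x t \<and> is_iso C t"
    have x: "monic C x" "x \<in> Hom C (Dom C x) L" using s monic_Ar by (auto simp: subobject_def Hom_def)
    note Z = t[unfolded sum_iso_iff[OF j x(2)]]
    obtain y where y: "is_cokernel C x y" using ex_cokernel x by (auto simp: Hom_def)
    note yH = cokernel_HomD[OF y x(2)]
    have "b \<cdot> y = Zero C L W"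
      if b: "b \<in> Hom C (Cod C y) W" "b \<cdot> y \<cdot> j = Zero C (Dom C j) W" for W b
    proof -
      have "b \<cdot> y \<cdot> x = b \<cdot> (y \<cdot> x)" using Comp_assoc b yH x by metis
      then have "b \<cdot> y \<cdot> x = Zero C (Dom C x) W"
        using yH b Comp_Zero_right[of b "Cod C y" "Dom C x"] Hom_Ob[OF x(2)] by (auto simp: Hom_def)
      moreover have "b \<cdot> y \<in> Hom C L W" using b yH Comp_Hom by blast
      ultimately show ?thesis using Z b by blast
    qed
    then have "y = Zero C L (Cod C y)" using R yH cokernel_epic[OF y] by blast
    then show "is_iso C x" using monic_zero_cokernel_iso[OF x(2,1) y] by blast
  qed (rule assms)
qed

end

section \<open>Envelopes of kernels and of images\<close>

lemma kernel_envelope_opposite: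
  "kernel_envelope (opposite C) N M f e \<longleftrightarrow> e \<in> Hom C N N \<and> e \<cdot>\<^bsub>C\<^esub> e = e \<and>
     (\<forall>X. \<forall>b\<in>Hom C N X. b \<cdot>\<^bsub>C\<^esub> f = Zero C M X \<longrightarrow> b \<cdot>\<^bsub>C\<^esub> e = b) \<and>
     (\<forall>X. \<forall>x\<in>Hom C N X. epic C x \<and> x \<cdot>\<^bsub>C\<^esub> e = x \<and>
        (\<forall>W. \<forall>b\<in>Hom C X W. b \<cdot>\<^bsub>C\<^esub> x \<cdot>\<^bsub>C\<^esub> f = Zero C M W \<longrightarrow> b \<cdot>\<^bsub>C\<^esub> x = Zero C N W)
        \<longrightarrow> x = Zero C N X)"
  unfolding kernel_envelope_def Hom_opposite opposite_simps monic_opposite ..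

context abelian_category
begin

text \<open>
  A direct summand \<open>u\<close> with projection \<open>p\<close> corresponds to the idempotent \<open>u \<cdot> p\<close>, and subobjects of the
  summand to monomorphisms into \<open>M\<close> fixed by that idempotent. For such a monomorphism \<open>x\<close>, the
  arrows through \<open>x\<close> killed by \<open>f\<close> are those that also factor through \<open>k\<close>, so the essentiality
  conditions on both sides agree.
\<close>

lemma kernel_essential_in_summand_iff:
  assumes f: "f \<in> Hom C M N" and k: "is_kernel C f k"
  shows "essential_in_direct_summand C k M \<longleftrightarrow> (\<exists>e. kernel_envelope C M N f e)"
proof
  note kH = kernel_HomD[OF k f] and kf = kernel_factor[OF k f]
  assume "essential_in_direct_summand C k M"
  then obtain u h where u: "direct_summand C u M" and h: "h \<in> Hom C (Dom C k) (Dom C u)"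
    "u \<cdot> h = k" "essential_in C h (Dom C u)"
    unfolding essential_in_direct_summand_def by blast
  obtain B v p q where bi: "is_biproduct C (Dom C u) B M u v p q"
    using u unfolding direct_summand_def by blast
  then have uH: "u \<in> Hom C (Dom C u) M" "p \<in> Hom C M (Dom C u)" "p \<cdot> u = Idt C (Dom C u)"
    by (auto simp: is_biproduct_def)
  have ob: "M \<in> Ob C" "N \<in> Ob C" "Dom C u \<in> Ob C" using f uH Hom_Ob by blast+
  have um: "monic C u" using u by (simp add: direct_summand_def subobject_def)
  have upu: "u \<cdot> p \<cdot> (u \<cdot> a) = u \<cdot> a" if "a \<in> Hom C X (Dom C u)" for X a
    using Comp_assoc[OF that uH(1,2)] uH(3) Comp_Idt_left[OF that]
      Comp_assoc[OF Comp_Hom[OF that uH(1)] uH(2,1)] by simp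
  have ess: "x = Zero C X (Dom C u)"
    if "x \<in> Hom C X (Dom C u)" "monic C x" "\<And>W a b. a \<in> Hom C W (Dom C h) \<Longrightarrow> b \<in> Hom C W X \<Longrightarrow>
      h \<cdot> a = x \<cdot> b \<Longrightarrow> x \<cdot> b = Zero C W (Dom C u)" for X x
    using h(3) that essential_in_iff[of h "Dom C u"] unfolding essential_in_def by blast
  have "kernel_envelope C M N f (u \<cdot> p)"
    unfolding kernel_envelope_def
  proof (intro conjI allI ballI impI; (elim conjE)?)
    show "u \<cdot> p \<in> Hom C M M" using uH Comp_Hom by blast
    show "u \<cdot> p \<cdot> (u \<cdot> p) = u \<cdot> p" using upu uH by blast
  next
    fix X b assume b: "b \<in> Hom C X M" "f \<cdot> b = Zero C X N"
    obtain t where t: "t \<in> Hom C X (Dom C k)" "k \<cdot> t = b" using kf b by blast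
    then have "b = u \<cdot> (h \<cdot> t)" using h Comp_assoc uH by metis
    then show "u \<cdot> p \<cdot> b = b" using upu h t Comp_Hom by metis
  next
    fix X x assume x: "x \<in> Hom C X M" "monic C x" "u \<cdot> p \<cdot> x = x"
      and Z: "\<forall>W. \<forall>b\<in>Hom C W X. f \<cdot> (x \<cdot> b) = Zero C W N \<longrightarrow> x \<cdot> b = Zero C W M"
    have X: "X \<in> Ob C" using x Hom_Ob by blast
    let ?y = "p \<cdot> x"
    have y: "?y \<in> Hom C X (Dom C u)" "u \<cdot> ?y = x"
      using x uH Comp_Hom Comp_assoc[OF x(1) uH(2,1)] by auto
    have ym: "monic C ?y" using monic_factor[of u ?y] x y uH by (auto simp: Hom_def)
    have "?y \<cdot> b = Zero C W (Dom C u)"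
      if ab: "a \<in> Hom C W (Dom C h)" "b \<in> Hom C W X" "h \<cdot> a = ?y \<cdot> b" for W a b
    proof -
      have a: "a \<in> Hom C W (Dom C k)" using ab h by (simp add: Hom_def)
      have W: "W \<in> Ob C" using ab Hom_Ob by blast
      have ka: "k \<cdot> a = x \<cdot> b" 
        using ab(3) h(2) y(2) Comp_assoc[OF a h(1) uH(1)] Comp_assoc[OF ab(2) y(1) uH(1)] by simp
      have "f \<cdot> (k \<cdot> a) = f \<cdot> k \<cdot> a" using Comp_assoc[OF a kH(1) f] by simp
      then have "f \<cdot> (x \<cdot> b) = Zero C W N"
        using ka kH a Comp_Zero_left[of a "Dom C k" N] ob by (auto simp: Hom_def)
      then have "x \<cdot> b = Zero C W M" using Z ab by blast
      then have "u \<cdot> (?y \<cdot> b) = Zero C W M" using y(2) Comp_assoc[OF ab(2) y(1) uH(1)] by simp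
      then show ?thesis using monic_zero_cancel[OF um, of "?y \<cdot> b"] Comp_Hom[OF ab(2) y(1)] uH
        by (auto simp: Hom_def)
    qed
    then have "?y = Zero C X (Dom C u)" using ess y ym by blast
    then have "u \<cdot> ?y = Zero C X M"
      using Comp_Zero_right[of u "Dom C u" X] uH X by (auto simp: Hom_def)
    then show "x = Zero C X M" using y by simp
  qed
  then show "\<exists>e. kernel_envelope C M N f e" by blast
next
  note kH = kernel_HomD[OF k f] and kf = kernel_factor[OF k f]
  assume "\<exists>e. kernel_envelope C M N f e"
  then obtain e where e: "e \<in> Hom C M M" "e \<cdot> e = e"
    and fix_e: "\<And>X b. b \<in> Hom C X M \<Longrightarrow> f \<cdot> b = Zero C X N \<Longrightarrow> e \<cdot> b = b"
    and ess: "\<And>X x. x \<in> Hom C X M \<Longrightarrow> monic C x \<Longrightarrow> e \<cdot> x = x \<Longrightarrow>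
      (\<And>W b. b \<in> Hom C W X \<Longrightarrow> f \<cdot> (x \<cdot> b) = Zero C W N \<Longrightarrow> x \<cdot> b = Zero C W M) \<Longrightarrow> x = Zero C X M"
    unfolding kernel_envelope_def by blast
  have M: "M \<in> Ob C" using f Hom_Ob by blast
  obtain d where "d \<in> Hom C M M" "Plus C e d = Idt C M" using ex_summand e M Idt_Hom by blast
  then obtain K B u v p q where bi: "is_biproduct C K B M u v p q" and up: "u \<cdot> p = e"
    using idempotent_biproduct e by blast
  have uH: "u \<in> Hom C K M" "p \<in> Hom C M K" "p \<cdot> u = Idt C K"
    using bi by (auto simp: is_biproduct_def)
  have K: "K \<in> Ob C" "Dom C u = K" using uH Hom_Ob by (auto simp: Hom_def)
  have um: "monic C u" using monic_left_inverse uH by blast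
  then have ds: "direct_summand C u M"
    unfolding direct_summand_def subobject_def using bi uH by (auto simp: Hom_def)
  let ?h = "p \<cdot> k"
  have h: "?h \<in> Hom C (Dom C k) K" using uH kH Comp_Hom by blast
  have uh: "u \<cdot> ?h = k" using fix_e[OF kH] up Comp_assoc[OF kH(1) uH(2,1)] by simp
  have hs: "subobject C ?h K"
    unfolding subobject_def using monic_factor[of u ?h] kernel_monic[OF k] uh h uH
    by (auto simp: Hom_def)
  have "essential_in C ?h K"
    unfolding essential_in_iff[OF hs]
  proof (intro allI ballI impI, elim conjE)
    fix X x assume x: "x \<in> Hom C X K" "monic C x"
      and Z: "\<forall>W. \<forall>a\<in>Hom C W (Dom C ?h). \<forall>b\<in>Hom C W X. ?h \<cdot> a = x \<cdot> b \<longrightarrow> x \<cdot> b = Zero C W K"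
    have X: "X \<in> Ob C" using x Hom_Ob by blast
    have ux: "u \<cdot> x \<in> Hom C X M" "monic C (u \<cdot> x)"
      using x uH Comp_Hom monic_Comp[OF x(2) um] by (auto simp: Hom_def)
    moreover have "e \<cdot> (u \<cdot> x) = u \<cdot> x"
      using Comp_assoc[OF x(1) uH(1,2)] uH(3) Comp_Idt_left[OF x(1)]
        Comp_assoc[OF Comp_Hom[OF x(1) uH(1)] uH(2,1)] up by simp
    moreover have "u \<cdot> x \<cdot> b = Zero C W M"
      if b: "b \<in> Hom C W X" "f \<cdot> (u \<cdot> x \<cdot> b) = Zero C W N" for W b
    proof -
      have W: "W \<in> Ob C" using b Hom_Ob by blast
      obtain t where t: "t \<in> Hom C W (Dom C k)" "k \<cdot> t = u \<cdot> x \<cdot> b"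
        using kf[of "u \<cdot> x \<cdot> b" W] b ux Comp_Hom by blast
      have xb: "u \<cdot> x \<cdot> b = u \<cdot> (x \<cdot> b)" using Comp_assoc b x uH by blast
      have "k \<cdot> t = u \<cdot> (?h \<cdot> t)" using uh Comp_assoc[OF t(1) h uH(1)] by simp
      then have "u \<cdot> (?h \<cdot> t) = u \<cdot> (x \<cdot> b)" using t xb by simp
      then have "?h \<cdot> t = x \<cdot> b"
        by - (rule monic_cancel[OF um]; use Comp_Hom[OF t(1) h] Comp_Hom[OF b(1) x(1)] uH in
          \<open>auto simp: Hom_def\<close>)
      moreover have "Dom C ?h = Dom C k" using h by (simp add: Hom_def)
      ultimately have "x \<cdot> b = Zero C W K" using Z t b by simp
      then show ?thesis using xb Comp_Zero_right[of u K W] uH W by (auto simp: Hom_def)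
    qed
    ultimately have "u \<cdot> x = Zero C X M" using ess by blast
    then show "x = Zero C X K" using monic_zero_cancel[OF um, of x] x uH by (auto simp: Hom_def)
  qed
  then show "essential_in_direct_summand C k M"
    unfolding essential_in_direct_summand_def subobject_def
    using ds uh h K kernel_monic[OF k] kH by (auto simp: Hom_def)
qed

text \<open>
  The arrow \<open>j : I/K \<rightarrow> N/K\<close> induced by a subobject \<open>I\<close> that contains the summand \<open>K\<close> of \<open>N\<close>. Here \<open>I/K\<close>
  embeds into \<open>I\<close> as a complement of \<open>K\<close>, so an arrow \<open>w\<close> killed by \<open>j\<close> lifts to an arrow into \<open>I\<close>
  which \<open>q \<cdot> i\<close> kills. That lift lands in \<open>K\<close>, so \<open>w\<close> is zero.
\<close>

lemma summand_quotient_monic: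
  assumes bi: "is_biproduct C K B N u v p q"
    and i: "monic C i" "i \<in> Hom C I N" and h: "h \<in> Hom C K I" "i \<cdot> h = u"
    and d: "is_cokernel C h d" and j: "j \<in> Hom C (Cod C d) B" "j \<cdot> d = q \<cdot> i"
  shows "monic C j"
proof (rule monic_if_zero_cancel[OF j(1)])
  have H: "u \<in> Hom C K N" "v \<in> Hom C B N" "p \<in> Hom C N K" "q \<in> Hom C N B" "p \<cdot> u = Idt C K"
    using bi by (auto simp: is_biproduct_def)
  note dH = cokernel_HomD[OF d h(1)]
  let ?Q = "Cod C d"
  have ob: "K \<in> Ob C" "B \<in> Ob C" "N \<in> Ob C" "I \<in> Ob C" "?Q \<in> Ob C"
    using H i dH Hom_Ob by blast+
  have A: "u \<in> Ar C" "Dom C u = K" "Cod C u = N" "p \<in> Ar C" "Dom C p = N" "Cod C p = K"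
    "v \<in> Ar C" "Dom C v = B" "Cod C v = N" "q \<in> Ar C" "Dom C q = N" "Cod C q = B"
    "i \<in> Ar C" "Dom C i = I" "Cod C i = N" "h \<in> Ar C" "Dom C h = K" "Cod C h = I"
    "d \<in> Ar C" "Dom C d = I" "j \<in> Ar C" "Dom C j = ?Q" "Cod C j = B"
    using H i h dH j by (auto simp: Hom_def)
  note [simp] = cat_simps
  \<comment> \<open>Since \<open>p \<cdot> i\<close> retracts \<open>h\<close>, the cokernel \<open>d\<close> has a section \<open>\<sigma>\<close>.\<close>
  have hr: "h \<cdot> (p \<cdot> i) \<in> Hom C I I" using h H i Comp_Hom by blast
  obtain n where n: "n \<in> Hom C I I" "Plus C (h \<cdot> (p \<cdot> i)) n = Idt C I"
    using ex_summand[OF hr Idt_Hom] ob by blast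
  have nA: "n \<in> Ar C" "Dom C n = I" "Cod C n = I" using n by (auto simp: Hom_def)
  have "Plus C (h \<cdot> (p \<cdot> i) \<cdot> h) (n \<cdot> h) = Idt C I \<cdot> h" using Comp_Plus_left[OF h(1) hr n(1)] n(2) by simp
  then have "Plus C h (n \<cdot> h) = h" using A h(2) H(5) ob by simp
  then have "n \<cdot> h = Zero C K I" using Plus_eq_imp_Zero h n Comp_Hom by blast
  then obtain \<sigma> where \<sigma>: "\<sigma> \<in> Hom C ?Q I" "\<sigma> \<cdot> d = n" using cokernel_factor[OF d h(1) n(1)] by blast
  have sA: "\<sigma> \<in> Ar C" "Dom C \<sigma> = ?Q" "Cod C \<sigma> = I" using \<sigma> by (auto simp: Hom_def)
  have "Plus C (d \<cdot> (h \<cdot> (p \<cdot> i))) (d \<cdot> n) = d \<cdot> Idt C I" using Comp_Plus_right[OF hr n(1) dH(1)] n(2) by simp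
  moreover have "d \<cdot> (h \<cdot> (p \<cdot> i)) = Zero C I ?Q"
  proof -
    have "d \<cdot> (h \<cdot> (p \<cdot> i)) = d \<cdot> h \<cdot> (p \<cdot> i)" using A by simp
    then show ?thesis using A dH(2) ob by simp
  qed
  ultimately have "d \<cdot> n = d" using Plus_Zero(2)[OF Comp_Hom[OF n(1) dH(1)]] A by simp
  then have "d \<cdot> \<sigma> \<cdot> d = Idt C ?Q \<cdot> d" using \<sigma>(2) A sA by simp
  then have ds: "d \<cdot> \<sigma> = Idt C ?Q"
    by - (rule epic_cancel[OF cokernel_epic[OF d]]; use A sA ob in auto)
  fix X w assume w: "w \<in> Hom C X ?Q" "j \<cdot> w = Zero C X B"
  have X: "X \<in> Ob C" using w Hom_Ob by blast
  have wA: "w \<in> Ar C" "Dom C w = X" "Cod C w = ?Q" using w by (auto simp: Hom_def)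
  let ?w = "\<sigma> \<cdot> w"
  have wH: "?w \<in> Hom C X I" using \<sigma> w Comp_Hom by blast
  have dw: "d \<cdot> ?w = w"
  proof -
    have "d \<cdot> ?w = d \<cdot> \<sigma> \<cdot> w" using A sA wA by simp
    then show ?thesis using ds wA by simp
  qed
  have "q \<cdot> i \<cdot> ?w = j \<cdot> (d \<cdot> ?w)" using j(2)[symmetric] A sA wA by simp
  then have "q \<cdot> (i \<cdot> ?w) = Zero C X B" using dw w A sA wA by simp
  then have "Plus C (u \<cdot> (p \<cdot> (i \<cdot> ?w))) (Zero C X N) = i \<cdot> ?w"
    using biproduct_decomposition[OF bi Comp_Hom[OF wH i(2)]] A X by simp
  moreover have "u \<cdot> (p \<cdot> (i \<cdot> ?w)) \<in> Hom C X N" using wH i H Comp_Hom by blast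
  ultimately have "u \<cdot> (p \<cdot> (i \<cdot> ?w)) = i \<cdot> ?w" using Plus_Zero by simp
  then have "i \<cdot> h \<cdot> (p \<cdot> (i \<cdot> ?w)) = i \<cdot> ?w" using h(2) by simp
  then have "i \<cdot> (h \<cdot> (p \<cdot> (i \<cdot> ?w))) = i \<cdot> ?w" using A sA wA by simp
  then have "h \<cdot> (p \<cdot> (i \<cdot> ?w)) = ?w"
    by - (rule monic_cancel[OF i(1)]; use A sA wA in auto)
  then have "w = d \<cdot> (h \<cdot> (p \<cdot> (i \<cdot> ?w)))" using dw by simp
  also have "\<dots> = d \<cdot> h \<cdot> (p \<cdot> (i \<cdot> ?w))" using A sA wA by simp
  also have "\<dots> = Zero C X ?Q" using dH(2) A sA wA ob by simp
  finally show "w = Zero C X ?Q" .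
qed

text \<open>
  The image is the kernel of the cokernel of \<open>f\<close>, and \<open>f\<close> factors through it. So an arrow that kills
  \<open>f\<close> factors through this cokernel and kills the image, and conversely.
\<close>

lemma image_kills_iff:
  assumes f: "f \<in> Hom C M N" and i: "is_image C f i"
  shows "monic C i" "i \<in> Hom C (Dom C i) N"
    and "z \<in> Hom C N Z \<Longrightarrow> z \<cdot> f = Zero C M Z \<longleftrightarrow> z \<cdot> i = Zero C (Dom C i) Z"
proof -
  obtain c where c: "is_cokernel C f c" "is_kernel C c i" using i unfolding is_image_def by blast
  note cH = cokernel_HomD[OF c(1) f]
  note iH = kernel_HomD[OF c(2) cH(1)]
  show "monic C i" "i \<in> Hom C (Dom C i) N" using iH kernel_monic c by blast+
  obtain g where g: "g \<in> Hom C M (Dom C i)" "i \<cdot> g = f"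
    using kernel_factor[OF c(2) cH(1) f cH(2)] by blast
  assume z: "z \<in> Hom C N Z"
  have ob: "Z \<in> Ob C" "Dom C i \<in> Ob C" using z iH Hom_Ob by blast+
  show "z \<cdot> f = Zero C M Z \<longleftrightarrow> z \<cdot> i = Zero C (Dom C i) Z"
  proof
    assume "z \<cdot> f = Zero C M Z"
    then obtain w where w: "w \<in> Hom C (Cod C c) Z" "w \<cdot> c = z"
      using cokernel_factor[OF c(1) f z] by blast
    have "z \<cdot> i = w \<cdot> (c \<cdot> i)" using w(2) Comp_assoc[OF iH(1) cH(1) w(1)] by simp
    then show "z \<cdot> i = Zero C (Dom C i) Z"
      using iH w Comp_Zero_right[of w "Cod C c" "Dom C i"] ob by (auto simp: Hom_def)
  next
    assume "z \<cdot> i = Zero C (Dom C i) Z"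
    moreover have "z \<cdot> f = z \<cdot> i \<cdot> g" using g(2) Comp_assoc[OF g(1) iH(1) z] by simp
    ultimately show "z \<cdot> f = Zero C M Z"
      using g Comp_Zero_left[of g "Dom C i" Z] ob by (auto simp: Hom_def)
  qed
qed

text \<open>
  For a summand \<open>k\<close> with complement inclusion \<open>v\<close> and projection \<open>q\<close>, the idempotent is \<open>v \<cdot> q\<close>, which kills
  \<open>k\<close>. The summand lies in the image of \<open>f\<close> if and only if every arrow \<open>b\<close> that kills \<open>f\<close> kills \<open>k\<close>,
  that is, satisfies \<open>b \<cdot> (v \<cdot> q) = b\<close>. The quotients \<open>x\<close> of \<open>N\<close> with \<open>x \<cdot> (v \<cdot> q) = x\<close> are the quotients
  of \<open>N/K\<close>, and an arrow from \<open>N/K\<close> kills the image modulo \<open>K\<close> if and only if its composite with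
  \<open>N \<rightarrow> N/K\<close> kills \<open>f\<close>. Under this correspondence the condition on superfluous subobjects is the
  last clause of the envelope.
\<close>

lemma image_above_summand_iff:
  assumes f: "f \<in> Hom C M N" and i: "is_image C f i"
  shows "lies_above_direct_summand C i N \<longleftrightarrow> (\<exists>e. kernel_envelope (opposite C) N M f e)"
proof
  note im = image_kills_iff[OF f i]
  assume "lies_above_direct_summand C i N"
  then obtain k h c d j where k: "direct_summand C k N" and h: "h \<in> Hom C (Dom C k) (Dom C i)" "i \<cdot> h = k"
    and c: "is_cokernel C k c" and d: "is_cokernel C h d"
    and j: "j \<in> Hom C (Cod C d) (Cod C c)" "j \<cdot> d = c \<cdot> i" and sup: "superfluous_in C j (Cod C c)"
    unfolding lies_above_direct_summand_def by blast
  obtain B v p q where bi: "is_biproduct C (Dom C k) B N k v p q"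
    using k unfolding direct_summand_def by blast
  then have H: "k \<in> Hom C (Dom C k) N" "v \<in> Hom C B N" "p \<in> Hom C N (Dom C k)" "q \<in> Hom C N B"
    "q \<cdot> v = Idt C B" "q \<cdot> k = Zero C (Dom C k) B"
    by (auto simp: is_biproduct_def)
  note cH = cokernel_HomD[OF c H(1)] and dH = cokernel_HomD[OF d h(1)]
  have ob: "N \<in> Ob C" "M \<in> Ob C" "B \<in> Ob C" "Dom C k \<in> Ob C" using f H Hom_Ob by blast+
  have supf: "y = Zero C (Cod C c) Y"
    if "y \<in> Hom C (Cod C c) Y" "epic C y" "\<And>Z b. b \<in> Hom C Y Z \<Longrightarrow>
      b \<cdot> y \<cdot> j = Zero C (Dom C j) Z \<Longrightarrow> b \<cdot> y = Zero C (Cod C c) Z" for Y y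
    using sup that superfluous_in_iff[of j "Cod C c"] unfolding superfluous_in_def by blast
  have "kernel_envelope (opposite C) N M f (v \<cdot> q)"
    unfolding kernel_envelope_opposite
  proof (intro conjI allI ballI impI; (elim conjE)?)
    show "v \<cdot> q \<in> Hom C N N" using H Comp_Hom by blast
    show "v \<cdot> q \<cdot> (v \<cdot> q) = v \<cdot> q"
      using Comp_assoc[OF H(4,2,4)] H(5) Comp_Idt_left[OF H(4)]
        Comp_assoc[OF Comp_Hom[OF H(4,2)] H(4,2)] by simp
  next
    fix X b assume b: "b \<in> Hom C N X" "b \<cdot> f = Zero C M X"
    have X: "X \<in> Ob C" using b Hom_Ob by blast
    have "b \<cdot> k = b \<cdot> i \<cdot> h" using h(2) Comp_assoc[OF h(1) im(2) b(1)] by simp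
    then have "b \<cdot> k = Zero C (Dom C k) X"
      using im(3) b h Comp_Zero_left[of h "Dom C i" X] X by (auto simp: Hom_def)
    then have "b \<cdot> k \<cdot> p = Zero C N X"
      using Comp_Zero_left[of p "Dom C k" X] X H by (auto simp: Hom_def)
    moreover have "b \<cdot> v \<cdot> q \<in> Hom C N X" using b H Comp_Hom by blast
    ultimately have "b \<cdot> v \<cdot> q = b" using biproduct_codecomposition[OF bi b(1)] Plus_Zero by metis
    then show "b \<cdot> (v \<cdot> q) = b" using Comp_assoc[OF H(4,2) b(1)] by simp
  next
    fix X x assume x: "x \<in> Hom C N X" "epic C x" "x \<cdot> (v \<cdot> q) = x"
      and Z: "\<forall>W. \<forall>b\<in>Hom C X W. b \<cdot> x \<cdot> f = Zero C M W \<longrightarrow> b \<cdot> x = Zero C N W"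
    have X: "X \<in> Ob C" using x Hom_Ob by blast
    have "x \<cdot> (v \<cdot> q) \<cdot> k = x \<cdot> v \<cdot> (q \<cdot> k)" using x(1) H by (auto simp: Hom_def cat_simps)
    then have "x \<cdot> k = x \<cdot> v \<cdot> (q \<cdot> k)" using x(3) by simp
    moreover have "x \<cdot> v \<in> Hom C B X" using x H Comp_Hom by blast
    ultimately have "x \<cdot> k = Zero C (Dom C k) X"
      using H(6) Comp_Zero_right[of "x \<cdot> v" B "Dom C k"] ob by (auto simp: Hom_def)
    then obtain y where y: "y \<in> Hom C (Cod C c) X" "y \<cdot> c = x" using cokernel_factor[OF c H(1) x(1)] by blast
    have cQ: "Cod C c \<in> Ob C" using y Hom_Ob by blast
    have "epic C y"
      using preadditive_category.monic_factor[OF preadditive_opposite, of C c y] preadditive_category_axioms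
        x(2) y cH by (auto simp: monic_opposite opposite_simps Hom_def)
    moreover have "b \<cdot> y = Zero C (Cod C c) W"
      if b: "b \<in> Hom C X W" "b \<cdot> y \<cdot> j = Zero C (Dom C j) W" for W b
    proof -
      have W: "W \<in> Ob C" using b Hom_Ob by blast
      have by_H: "b \<cdot> y \<in> Hom C (Cod C c) W" using b y Comp_Hom by blast
      have byc: "b \<cdot> y \<cdot> c = b \<cdot> x" using y(2) Comp_assoc[OF cH(1) y(1) b(1)] by simp
      have "b \<cdot> x \<cdot> i = b \<cdot> y \<cdot> j \<cdot> d"
        using byc j(2) Comp_assoc[OF im(2) cH(1) by_H] Comp_assoc[OF dH(1) j(1) by_H] by simp
      then have "b \<cdot> x \<cdot> i = Zero C (Dom C i) W"
        using b j dH Comp_Zero_left[of d "Dom C j" W] W by (auto simp: Hom_def)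
      then have "b \<cdot> x = Zero C N W" using im(3)[OF Comp_Hom[OF x(1) b(1)]] Z b(1) by blast
      then have "b \<cdot> y \<cdot> c = Zero C (Dom C c) (Cod C (b \<cdot> y))" using byc cH by_H by (simp add: Hom_def)
      then show ?thesis using epic_zero_cancel[OF cokernel_epic[OF c], of "b \<cdot> y"] by_H by (simp add: Hom_def)
    qed
    ultimately have "y = Zero C (Cod C c) X" using supf y by blast
    then show "x = Zero C N X"
      using y(2) Comp_Zero_left[of c "Cod C c" X] cH X by (auto simp: Hom_def)
  qed
  then show "\<exists>e. kernel_envelope (opposite C) N M f e" by blast
next
  note im = image_kills_iff[OF f i]
  assume "\<exists>e. kernel_envelope (opposite C) N M f e"
  then obtain e where e: "e \<in> Hom C N N" "e \<cdot> e = e"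
    and fix_e: "\<And>X b. b \<in> Hom C N X \<Longrightarrow> b \<cdot> f = Zero C M X \<Longrightarrow> b \<cdot> e = b"
    and ess: "\<And>X x. x \<in> Hom C N X \<Longrightarrow> epic C x \<Longrightarrow> x \<cdot> e = x \<Longrightarrow>
      (\<And>W b. b \<in> Hom C X W \<Longrightarrow> b \<cdot> x \<cdot> f = Zero C M W \<Longrightarrow> b \<cdot> x = Zero C N W) \<Longrightarrow> x = Zero C N X"
    unfolding kernel_envelope_opposite by blast
  have N: "N \<in> Ob C" using f Hom_Ob by blast
  obtain a where a: "a \<in> Hom C N N" "Plus C e a = Idt C N" using ex_summand e N Idt_Hom by blast
  \<comment> \<open>The summand to be found is the image of the complementary idempotent \<open>a = 1 - e\<close>.\<close>
  then have "Plus C a e = Idt C N" using Plus_commute e by metis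
  then obtain K B u v p q where bi: "is_biproduct C K B N u v p q" and vq: "v \<cdot> q = e"
    using idempotent_biproduct[OF a(1) complement_idempotent(3)[OF e a] e(1)] by blast
  have H: "u \<in> Hom C K N" "v \<in> Hom C B N" "p \<in> Hom C N K" "q \<in> Hom C N B"
    "q \<cdot> v = Idt C B" "q \<cdot> u = Zero C K B" "p \<cdot> u = Idt C K"
    using bi by (auto simp: is_biproduct_def)
  have ob: "K \<in> Ob C" "B \<in> Ob C" "M \<in> Ob C" using f H Hom_Ob by blast+
  have D: "Dom C u = K" "Cod C q = B" using H by (auto simp: Hom_def)
  have ds: "direct_summand C u N"
    unfolding direct_summand_def subobject_def using bi monic_left_inverse H by (auto simp: Hom_def)
  have q: "is_cokernel C u q" using biproduct_cokernel[OF bi] .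
  obtain c where c: "is_cokernel C f c" "is_kernel C c i" using i unfolding is_image_def by blast
  note cH = cokernel_HomD[OF c(1) f]
  have "c \<cdot> (v \<cdot> q) \<cdot> u = c \<cdot> v \<cdot> (q \<cdot> u)" using cH(1) H by (auto simp: Hom_def cat_simps)
  then have "c \<cdot> u = c \<cdot> v \<cdot> (q \<cdot> u)" using fix_e[OF cH] vq by simp
  moreover have "c \<cdot> v \<in> Hom C B (Cod C c)" using cH H Comp_Hom by blast
  ultimately have "c \<cdot> u = Zero C K (Cod C c)"
    using H(6) Comp_Zero_right[of "c \<cdot> v" B K] ob by (auto simp: Hom_def)
  then obtain h where h: "h \<in> Hom C K (Dom C i)" "i \<cdot> h = u"
    using kernel_factor[OF c(2) cH(1) H(1)] by blast
  obtain d where d: "is_cokernel C h d" using ex_cokernel h by (auto simp: Hom_def)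
  note dH = cokernel_HomD[OF d h(1)]
  have qi: "q \<cdot> i \<in> Hom C (Dom C i) B" using im H Comp_Hom by blast
  have "q \<cdot> i \<cdot> h = Zero C K B" using h(2) H(6) Comp_assoc[OF h(1) im(2) H(4)] by simp
  then obtain j where j: "j \<in> Hom C (Cod C d) B" "j \<cdot> d = q \<cdot> i"
    using cokernel_factor[OF d h(1) qi] by blast
  have js: "subobject C j B"
    unfolding subobject_def using summand_quotient_monic[OF bi im(1,2) h d j] j by (auto simp: Hom_def)
  have Dj: "Dom C j = Cod C d" using j by (simp add: Hom_def)
  have qe: "epic C q" using cokernel_epic[OF q] .
  have "superfluous_in C j B"
    unfolding superfluous_in_iff[OF js]
  proof (intro allI ballI impI, elim conjE)
    fix Y y assume y: "y \<in> Hom C B Y" "epic C y"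
      and Z: "\<forall>Z. \<forall>b\<in>Hom C Y Z. b \<cdot> y \<cdot> j = Zero C (Dom C j) Z \<longrightarrow> b \<cdot> y = Zero C B Z"
    have yq: "y \<cdot> q \<in> Hom C N Y" using y H Comp_Hom by blast
    have "epic C (y \<cdot> q)"
      using preadditive_category.monic_Comp[OF preadditive_opposite, of C y q] preadditive_category_axioms
        y qe H by (auto simp: monic_opposite opposite_simps Hom_def)
    moreover have "y \<cdot> q \<cdot> e = y \<cdot> q"
    proof -
      have "q \<cdot> (v \<cdot> q) = q" using Comp_assoc[OF H(4,2,4)] H(5) Comp_Idt_left[OF H(4)] by simp
      then show ?thesis using vq Comp_assoc[OF e(1) H(4) y(1)] by simp
    qed
    moreover have "b \<cdot> (y \<cdot> q) = Zero C N W"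
      if b: "b \<in> Hom C Y W" "b \<cdot> (y \<cdot> q) \<cdot> f = Zero C M W" for W b
    proof -
      have W: "W \<in> Ob C" using b Hom_Ob by blast
      have by_H: "b \<cdot> y \<in> Hom C B W" and bj: "b \<cdot> y \<cdot> j \<in> Hom C (Cod C d) W"
        using b y j Comp_Hom by blast+
      have byq: "b \<cdot> (y \<cdot> q) = b \<cdot> y \<cdot> q" using Comp_assoc[OF H(4) y(1) b(1)] by simp
      have "b \<cdot> (y \<cdot> q) \<cdot> i = Zero C (Dom C i) W" 
        using im(3)[OF Comp_Hom[OF yq b(1)]] b(2) by blast
      moreover have "b \<cdot> y \<cdot> j \<cdot> d = b \<cdot> (y \<cdot> q) \<cdot> i"
        using byq j(2) Comp_assoc[OF im(2) H(4) by_H] Comp_assoc[OF dH(1) j(1) by_H] by simp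
      ultimately have "b \<cdot> y \<cdot> j = Zero C (Cod C d) W"
        using epic_zero_cancel[OF cokernel_epic[OF d], of "b \<cdot> y \<cdot> j"] bj dH by (simp add: Hom_def)
      then have "b \<cdot> y = Zero C B W" using Z b Dj by simp
      then show ?thesis using byq Comp_Zero_left[of q B W] H W by (auto simp: Hom_def)
    qed
    ultimately have "y \<cdot> q = Zero C N Y" using ess yq by blast
    then show "y = Zero C B Y"
      using epic_zero_cancel[OF qe, of y] y H by (auto simp: Hom_def)
  qed
  moreover have "subobject C i N" using im by (auto simp: subobject_def Hom_def)
  ultimately show "lies_above_direct_summand C i N"
    unfolding lies_above_direct_summand_def using ds h q d j D by metis
qed

lemma CS_Rickart_iff:
  "CS_Rickart C M N \<longleftrightarrow> (\<forall>f\<in>Hom C M N. \<exists>e. kernel_envelope C M N f e)"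
proof -
  have "(\<forall>k. is_kernel C f k \<longrightarrow> essential_in_direct_summand C k M) \<longleftrightarrow> (\<exists>e. kernel_envelope C M N f e)"
    if f: "f \<in> Hom C M N" for f
    using kernel_essential_in_summand_iff[OF f] ex_kernel[of f] f by (auto simp: Hom_def)
  then show ?thesis unfolding CS_Rickart_def by blast
qed

lemma dual_CS_Rickart_iff:
  "dual_CS_Rickart C M N \<longleftrightarrow> (\<forall>f\<in>Hom C M N. \<exists>e. kernel_envelope (opposite C) N M f e)"
proof -
  have "(\<forall>i. is_image C f i \<longrightarrow> lies_above_direct_summand C i N) \<longleftrightarrow>
      (\<exists>e. kernel_envelope (opposite C) N M f e)" if f: "f \<in> Hom C M N" for f
  proof -
    obtain c where c: "is_cokernel C f c" using ex_cokernel f by (auto simp: Hom_def)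
    moreover have "c \<in> Ar C" using c by (simp add: is_cokernel_def)
    moreover from this obtain i where "is_kernel C c i" using ex_kernel by blast
    ultimately have "is_image C f i" unfolding is_image_def by blast
    then show ?thesis using image_above_summand_iff[OF f] by blast
  qed
  then show ?thesis unfolding dual_CS_Rickart_def by blast
qed

end

section \<open>Transfer of the CS-Rickart properties\<close>

theorem theorem3p1:
  fixes C :: "('o, 'm, 'z) precat_scheme"
    and M M' N N' :: 'o and r s :: 'm
  assumes "abelian_category C"
    and "r \<in> Hom C M M'" and "epic C r"
    and "s \<in> Hom C N' N" and "monic C s"
  shows "(is_retraction C r \<and> CS_Rickart C M N \<longrightarrow> CS_Rickart C M' N') \<and>
    (is_section C s \<and> dual_CS_Rickart C M N \<longrightarrow> dual_CS_Rickart C M' N')"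
proof -
  interpret abelian_category C by fact
  interpret op: preadditive_category "opposite C"
    by (rule preadditive_opposite) (rule preadditive_category_axioms)
  note r = assms(2,3) and s = assms(4,5)
  have sfr: "s \<cdot>\<^bsub>C\<^esub> (f \<cdot>\<^bsub>C\<^esub> r) \<in> Hom C M N" if "f \<in> Hom C M' N'" for f
    using that r s Comp_Hom by blast
  show ?thesis
  proof (intro conjI impI, elim conjE)
    assume "is_retraction C r" and R: "CS_Rickart C M N"
    then obtain g where g: "g \<in> Hom C M' M" "r \<cdot>\<^bsub>C\<^esub> g = Idt C M'"
      using r by (auto simp: is_retraction_def Hom_def)
    show "CS_Rickart C M' N'"
      using R kernel_envelope_descends[OF r(1) g s] sfr unfolding CS_Rickart_iff by meson
  next
    assume "is_section C s \<and> dual_CS_Rickart C M N"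
    then obtain t where t: "t \<in> Hom C N N'" "t \<cdot>\<^bsub>C\<^esub> s = Idt C N'" and R: "dual_CS_Rickart C M N"
      using s by (auto simp: is_section_def Hom_def)
    \<comment> \<open>In the opposite category, \<open>s\<close> is a retraction with section \<open>t\<close>, and \<open>r\<close> is monic.\<close>
    show "dual_CS_Rickart C M' N'"
      unfolding dual_CS_Rickart_iff
    proof
      fix f assume f: "f \<in> Hom C M' N'"
      obtain e where "kernel_envelope (opposite C) N M (s \<cdot>\<^bsub>C\<^esub> (f \<cdot>\<^bsub>C\<^esub> r)) e"
        using R sfr[OF f] unfolding dual_CS_Rickart_iff by blast
      moreover have "s \<cdot>\<^bsub>C\<^esub> (f \<cdot>\<^bsub>C\<^esub> r) = s \<cdot>\<^bsub>C\<^esub> f \<cdot>\<^bsub>C\<^esub> r" using Comp_assoc[OF r(1) f s(1)] by simp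
      ultimately show "\<exists>e. kernel_envelope (opposite C) N' M' f e"
        using op.kernel_envelope_descends[of s N N' t r M' M f e] r s t f
        unfolding Hom_opposite opposite_simps monic_opposite by auto
    qed
  qed
qed

end
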